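(* Let $f\in\mathrm{RV}_{-1}$ be the radius distribution and assume that for all $\beta\in(0,1)$: $$\limsup_{n\to\infty}\sup_{n^\beta\le x\le n}\frac{xf(x)}{nf(n)}=b(\beta)<\infty\quad\text{and}\quad\limsup_{n\to\infty}\frac{\sum_{i=1}^{n^\beta}f(i)}{f(n)\,n\ln n}=d(\beta)<\infty.$$ Then $(T_nf(n))_n$ is tight. Moreover, for every subsequence $(n_k)_k$ such that $f(n_k)T_{n_k}\Longrightarrow Y$ in distribution, the limit $Y$ (which may depend on $f$ and $(n_k)_k$) is a non-degenerate distribution with compact support.
   Context: Covering process: $R$ takes values in $\{1,2,\dots\}$, $f(r)=\mathbb{P}(R\ge r)$ for real $r\ge1$. On $\mathbb{Z}/n\mathbb{Z}$, let $(R_k)$ be i.i.d. copies of $R$, $(U_k)$ i.i.d. uniform on $\mathbb{Z}/n\mathbb{Z}$, independent; $\mathcal{O}_k=\{U_k,\dots,U_k+R_k-1\}$ (mod $n$), $C_0=\emptyset$, $C_k=C_{k-1}\cup\mathcal{O}_k$; with an independent rate-one Poisson process $N(t)$, $X_t=C_{N(t)}$ and $T_n=\inf\{t:X_t=\mathbb{Z}/n\mathbb{Z}\}$. $U\in\mathrm{RV}_p$ means $U:\mathbb{R}_+\to\mathbb{R}_+$ measurable with $\lim_{x\to\infty}U(xt)/U(x)=t^p$ for all $t>0$. Non-degenerate means not concentrated on a single point. *)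

theory Defs
  imports "HOL-Probability.Probability"
begin

definition regvar :: "real \<Rightarrow> (real \<Rightarrow> real) \<Rightarrow> bool" where
  "regvar p U \<longleftrightarrow>
     U \<in> borel_measurable (restrict_space borel {0..}) \<and>
     (\<forall>x\<ge>0. U x \<ge> 0) \<and>
     (\<forall>t>0. ((\<lambda>x. U (x * t) / U x) \<longlongrightarrow> t powr p) at_top)"

definition arc :: "nat \<Rightarrow> nat \<Rightarrow> nat \<Rightarrow> nat set" where
  "arc n u r = {(u + i) mod n | i. i < r}"

definition covered :: "nat \<Rightarrow> (nat \<Rightarrow> nat) \<Rightarrow> (nat \<Rightarrow> nat) \<Rightarrow> nat \<Rightarrow> nat set" where
  "covered n U R k = (\<Union>j<k. arc n (U j) (R j))"

text \<open>Rate-one Poisson process built from inter-arrival times E 0, E 1, ...: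
  N(t) = number of k \<ge> 1 with E 0 + ... + E (k-1) \<le> t.\<close>
definition poisson_count :: "(nat \<Rightarrow> real) \<Rightarrow> real \<Rightarrow> nat" where
  "poisson_count E t = card {k. 1 \<le> k \<and> (\<Sum>i<k. E i) \<le> t}"

definition cover_time :: "nat \<Rightarrow> (nat \<Rightarrow> nat) \<Rightarrow> (nat \<Rightarrow> nat) \<Rightarrow> (nat \<Rightarrow> real) \<Rightarrow> real" where
  "cover_time n U R E = Inf {t. 0 \<le> t \<and> covered n U R (poisson_count E t) = {0..<n}}"

end

theory Submission
  imports Defs "HOL-Real_Asymp.Real_Asymp"
begin

text \<open>
  By concentration of sums of exponential variables, the Poisson clock may be replaced by the number
  of arcs: it suffices to study the probability that \<open>k\<close> arcs do not cover, for \<open>k\<close> of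
  order \<open>1 / f n\<close>. Tightness is immediate, because an arc of length at least \<open>n\<close> covers everything
  and appears with probability \<open>f n\<close>; the same arcs give mass near \<open>0\<close> to every limit.

  Compact support uses regular variation only. Cut the circle into about \<open>m\<close> cells of length \<open>n / m\<close>.
  A cell lies inside a single random arc with probability at least about \<open>f n * (ln m - 1) / 2\<close>, so for
  \<open>k = 8 / f n\<close> the union bound over the cells is of order \<open>m powr (-3)\<close>, and \<open>m\<close> is arbitrary.

  Limits are not concentrated at \<open>0\<close> by a second moment estimate for the number of uncovered sites
  after \<open>k = \<eta> / f n\<close> arcs. Sites at distance \<open>d\<close> are correlated by a factor of at most
  \<open>(n / d) powr c\<close> with small \<open>c\<close> when \<open>d \<ge> sqrt n\<close> (first condition), and by at most
  \<open>sqrt n\<close> otherwise (both conditions). These factors have bounded average over \<open>d \<le> n\<close>.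
\<close>

section \<open>Arcs and the Poisson clock\<close>

lemma covered_mono: "k \<le> l \<Longrightarrow> covered n U R k \<subseteq> covered n U R l"
  by (force simp: covered_def)

lemma covered_subset: "1 \<le> n \<Longrightarrow> covered n U R k \<subseteq> {0..<n}"
  by (auto simp: covered_def arc_def)

text \<open>\<open>(x + n - u) mod n\<close> counts the steps from \<open>u\<close> forward to
  \<open>x\<close>; adding \<open>n\<close> first keeps the natural subtraction from
  truncating.\<close>

lemma mem_arc_iff:
  assumes "x < n" "u < n"
  shows "x \<in> arc n u r \<longleftrightarrow> (x + n - u) mod n < r"
proof
  assume "x \<in> arc n u r"
  then obtain i where i: "x = (u + i) mod n" "i < r" by (auto simp: arc_def)
  have "(x + (n - u)) mod n = (u + i + (n - u)) mod n" unfolding i(1) by (simp add: mod_add_left_eq)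
  also have "\<dots> = (i + n) mod n" using assms by (simp add: algebra_simps)
  finally have "(x + n - u) mod n = i mod n" using assms by simp
  then show "(x + n - u) mod n < r" using i(2) by (metis le_less_trans mod_less_eq_dividend)
next
  assume r: "(x + n - u) mod n < r"
  have "(u + (x + n - u) mod n) mod n = (u + (x + n - u)) mod n" by (simp add: mod_add_right_eq)
  also have "\<dots> = x" using assms by simp
  finally show "x \<in> arc n u r" using r by (force simp: arc_def)
qed

text \<open>The map from \<open>u\<close> to \<open>(x + n - u) mod n\<close> is an involution of
  \<open>{..<n}\<close>. It turns an average over uniform starting points into an average over the
  distance from the start of an arc to the site \<open>x\<close>.\<close>

lemma sum_shift_mod:
  fixes g :: "nat \<Rightarrow> 'b::comm_monoid_add"
  assumes "x < n"
  shows "(\<Sum>u<n. g ((x + n - u) mod n)) = (\<Sum>d<n. g d)"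
proof -
  have inv: "(x + n - (x + n - u) mod n) mod n = u" if "u < n" for u
  proof (cases "u \<le> x")
    case True
    then have "(x + n - u) mod n = x - u" using assms
      by (metis Nat.add_diff_assoc2 le_less_trans diff_le_self mod_add_self2 mod_less)
    then show ?thesis using True that by simp
  next
    case False
    then have "(x + n - u) mod n = x + n - u" using assms by (intro mod_less) linarith
    then show ?thesis using that False by simp
  qed
  show ?thesis
    by (rule sum.reindex_bij_witness[where i = "\<lambda>d. (x + n - d) mod n" and j = "\<lambda>u. (x + n - u) mod n"])
      (use inv assms in auto)
qed

lemma sum_nonneg_mono:
  fixes E :: "nat \<Rightarrow> real"
  assumes "\<And>i. 0 \<le> E i" "k \<le> l"
  shows "(\<Sum>i<k. E i) \<le> (\<Sum>i<l. E i)"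
  using assms by (intro sum_mono2) auto

text \<open>Nonnegative increments make the counted set an interval \<open>{1..N}\<close>, and
  unbounded partial sums keep it finite; on an infinite set \<open>card\<close> would return
  0.\<close>

lemma le_poisson_count_iff:
  fixes E :: "nat \<Rightarrow> real"
  assumes E: "\<And>i. 0 \<le> E i" and unb: "\<And>x. \<exists>k. x < (\<Sum>i<k. E i)" and t: "0 \<le> t"
  shows "k \<le> poisson_count E t \<longleftrightarrow> (\<Sum>i<k. E i) \<le> t"
proof -
  let ?A = "{k. 1 \<le> k \<and> (\<Sum>i<k. E i) \<le> t}"
  have sub: "?A \<subseteq> {1..<l}" if "t < (\<Sum>i<l. E i)" for l
  proof
    fix m assume m: "m \<in> ?A"
    have "\<not> l \<le> m" using sum_nonneg_mono[of E l m] E m that by auto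
    then show "m \<in> {1..<l}" using m by auto
  qed
  obtain K where "t < (\<Sum>i<K. E i)" using unb by blast
  from sub[OF this] have fin: "finite ?A" using finite_subset by blast
  show ?thesis
  proof
    assume k: "k \<le> poisson_count E t"
    show "(\<Sum>i<k. E i) \<le> t"
    proof (rule ccontr)
      assume "\<not> ?thesis"
      then have lt: "t < (\<Sum>i<k. E i)" by simp
      then have "card ?A \<le> k - 1" using card_mono[OF _ sub[OF lt]] by simp
      moreover have "k \<noteq> 0" using lt t by (intro notI) simp
      ultimately show False using k by (simp add: poisson_count_def)
    qed
  next
    assume S: "(\<Sum>i<k. E i) \<le> t"
    have "{1..k} \<subseteq> ?A"
      using sum_nonneg_mono[of E _ k] E S by (auto intro: order_trans[OF _ S])
    from card_mono[OF fin this] show "k \<le> poisson_count E t" by (simp add: poisson_count_def)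
  qed
qed

text \<open>The clock has counted \<open>k\<close> arcs exactly from the \<open>k\<close>-th arrival
  time on, so knowing whether \<open>k\<close> arcs cover places the cover time on one side of that
  arrival time. The covering index \<open>l\<close> makes the set under \<open>Inf\<close>
  nonempty.\<close>

lemma cover_time_bounds:
  fixes E :: "nat \<Rightarrow> real"
  assumes E: "\<And>i. 0 \<le> E i" and unb: "\<And>x. \<exists>k. x < (\<Sum>i<k. E i)" and n: "1 \<le> n"
    and full: "covered n U R l = {0..<n}"
  shows "0 \<le> cover_time n U R E"
    and "covered n U R k = {0..<n} \<Longrightarrow> cover_time n U R E \<le> (\<Sum>i<k. E i)"
    and "covered n U R k \<noteq> {0..<n} \<Longrightarrow> (\<Sum>i<k. E i) \<le> cover_time n U R E"
proof -
  let ?T = "{t. 0 \<le> t \<and> covered n U R (poisson_count E t) = {0..<n}}"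
  have mem: "(\<Sum>i<k. E i) \<in> ?T" if "covered n U R k = {0..<n}" for k
  proof -
    have nn: "0 \<le> (\<Sum>i<k. E i)" by (intro sum_nonneg) (simp add: E)
    have "k \<le> poisson_count E (\<Sum>i<k. E i)" using le_poisson_count_iff[OF E unb nn] by simp
    from covered_mono[OF this, of n U R] show ?thesis
      using that covered_subset[OF n, of U R] nn by auto
  qed
  have ne: "?T \<noteq> {}" using mem[OF full] by blast
  have bdd: "bdd_below ?T" by (rule bdd_belowI[where m = 0]) simp
  show "0 \<le> cover_time n U R E" unfolding cover_time_def by (rule cInf_greatest[OF ne]) simp
  show "cover_time n U R E \<le> (\<Sum>i<k. E i)" if "covered n U R k = {0..<n}"
    unfolding cover_time_def by (rule cInf_lower[OF mem[OF that] bdd])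
  show "(\<Sum>i<k. E i) \<le> cover_time n U R E" if "covered n U R k \<noteq> {0..<n}"
    unfolding cover_time_def
  proof (rule cInf_greatest[OF ne])
    fix t assume t: "t \<in> ?T"
    have "k \<le> poisson_count E t"
    proof (rule ccontr)
      assume "\<not> ?thesis"
      then have "covered n U R (poisson_count E t) \<subseteq> covered n U R k" by (intro covered_mono) simp
      then show False using t that covered_subset[OF n, of U R k] by auto
    qed
    then show "(\<Sum>i<k. E i) \<le> t" using le_poisson_count_iff[OF E unb, of t k] t by simp
  qed
qed

text \<open>If \<^term>\<open>X\<close> is not measurable, then the set function pushed forward by \<^const>\<open>distr\<close> is not
  additive, and \<^const>\<open>distr\<close> falls back to the null measure.\<close>

lemma (in prob_space) borel_measurable_of_cdf_distr_nonzero: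
  fixes X :: "'a \<Rightarrow> real"
  assumes "cdf (distr M borel X) x \<noteq> 0"
  shows "X \<in> borel_measurable M"
proof -
  let ?\<mu> = "\<lambda>A. emeasure M (X -` A \<inter> space M)"
  have "emeasure (distr M borel X) {..x} \<noteq> 0"
    using assms by (auto simp: cdf_def measure_def)
  then have ms: "measure_space (space borel) (sigma_sets (space borel) (sets borel)) ?\<mu>"
    by (auto simp: distr_def emeasure_measure_of_conv split: if_splits)
  show ?thesis
  proof (rule measurableI)
    fix A :: "real set" assume A: "A \<in> sets borel"
    have "countably_additive (sets borel) ?\<mu>" "positive (sets borel) ?\<mu>"
      using ms sets.sigma_sets_eq[of "borel :: real measure"] by (auto simp: measure_space_def)
    then have "additive (sets borel) ?\<mu>"
      by (rule ring_of_sets.countably_additive_additive[OF sets.ring_of_sets_axioms, rotated])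
    from additiveD[OF this, of A "- A"] A
    have sum: "1 = ?\<mu> A + ?\<mu> (- A)"
      by (simp add: emeasure_space_1)
    show "X -` A \<inter> space M \<in> sets M"
    \<comment> \<open>The preimages of \<open>A\<close> and \<open>- A\<close> would both fail to be
      measurable and get the default \<open>emeasure\<close> 0, although the two values must add up
      to 1.\<close>
    proof (rule ccontr)
      assume nm: "X -` A \<inter> space M \<notin> sets M"
      have "X -` (- A) \<inter> space M \<notin> sets M"
      proof
        assume "X -` (- A) \<inter> space M \<in> sets M"
        then have "space M - X -` (- A) \<inter> space M \<in> sets M" by (rule sets.compl_sets)
        also have "space M - X -` (- A) \<inter> space M = X -` A \<inter> space M" by auto
        finally show False using nm by simp
      qed
      with nm sum show False by (simp add: emeasure_notin_sets)
    qed
  qed simp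
qed

section \<open>Second moments, sums and limits\<close>

text \<open>This is the second moment method: if \<open>Z\<close> counts the events that occur, the
  square of its mean is at most the probability of \<open>Z > 0\<close> times the mean of its
  square.\<close>

lemma (in prob_space) second_moment_Union:
  assumes fin: "finite I" and A: "\<And>i. i \<in> I \<Longrightarrow> A i \<in> events"
  shows "(\<Sum>i\<in>I. prob (A i))\<^sup>2 \<le> prob (\<Union>i\<in>I. A i) * (\<Sum>i\<in>I. \<Sum>j\<in>I. prob (A i \<inter> A j))"
proof -
  define Z where "Z \<omega> = (\<Sum>i\<in>I. indicator (A i) \<omega> :: real)" for \<omega>
  define m where "m = (\<Sum>i\<in>I. prob (A i))"
  define v where "v = (\<Sum>i\<in>I. \<Sum>j\<in>I. prob (A i \<inter> A j))"
  have U: "(\<Union>i\<in>I. A i) \<in> events" using fin A by auto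
  have Z2: "(Z \<omega>)\<^sup>2 = (\<Sum>i\<in>I. \<Sum>j\<in>I. indicator (A i \<inter> A j) \<omega>)" for \<omega>
    by (simp add: Z_def power2_eq_square sum_product indicator_inter_arith)
  have iZ: "integrable M Z" and eZ: "expectation Z = m"
    unfolding Z_def[abs_def] m_def using A by (auto simp: emeasure_eq_measure)
  have iZ2: "integrable M (\<lambda>\<omega>. (Z \<omega>)\<^sup>2)" and eZ2: "expectation (\<lambda>\<omega>. (Z \<omega>)\<^sup>2) = v"
    unfolding Z2 v_def using A by (auto simp: emeasure_eq_measure)
  \<comment> \<open>Cauchy--Schwarz for \<open>Z\<close> and the indicator of \<open>Z \<noteq> 0\<close>, optimised over \<open>t\<close> below.\<close>
  have key: "2 * t * m \<le> v + t\<^sup>2 * prob (\<Union>i\<in>I. A i)" for t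
  proof -
    have "2 * t * Z \<omega> \<le> (Z \<omega>)\<^sup>2 + t\<^sup>2 * indicator (\<Union>i\<in>I. A i) \<omega>" for \<omega>
    proof (cases "\<omega> \<in> (\<Union>i\<in>I. A i)")
      case True
      then show ?thesis using sum_squares_bound[of t "Z \<omega>"] by simp
    next
      case False
      then have "Z \<omega> = 0" by (simp add: Z_def)
      then show ?thesis by simp
    qed
    then have "expectation (\<lambda>\<omega>. 2 * t * Z \<omega>) \<le> expectation (\<lambda>\<omega>. (Z \<omega>)\<^sup>2 + t\<^sup>2 * indicator (\<Union>i\<in>I. A i) \<omega>)"
      using U iZ iZ2 by (intro integral_mono) (auto simp: emeasure_eq_measure)
    then show ?thesis using U iZ iZ2 by (simp add: eZ eZ2 emeasure_eq_measure)
  qed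
  have "0 \<le> v" unfolding v_def by (intro sum_nonneg) auto
  then consider "m = 0" | "m \<noteq> 0" "v = 0" | "m \<noteq> 0" "0 < v" by fastforce
  then have "m\<^sup>2 \<le> prob (\<Union>i\<in>I. A i) * v"
  proof cases
    case 1
    then show "m\<^sup>2 \<le> prob (\<Union>i\<in>I. A i) * v" using \<open>0 \<le> v\<close> by simp
  next
    case 2
    have "2 * m * m \<le> v + m\<^sup>2 * prob (\<Union>i\<in>I. A i)" by (rule key)
    moreover have "m\<^sup>2 * prob (\<Union>i\<in>I. A i) \<le> m\<^sup>2 * 1" by (intro mult_left_mono) auto
    ultimately have "2 * m\<^sup>2 \<le> m\<^sup>2" using 2 unfolding power2_eq_square by linarith
    then show ?thesis using 2 by simp
  next
    case 3
    \<comment> \<open>With \<open>t = v/m\<close> the left side is \<open>2 * v\<close>, and the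
      claim follows without dividing by the probability of the union.\<close>
    have "2 * (v/m) * m \<le> v + (v/m)\<^sup>2 * prob (\<Union>i\<in>I. A i)" by (rule key)
    then have "v \<le> v * (v * prob (\<Union>i\<in>I. A i) / m\<^sup>2)" using 3 by (simp add: power2_eq_square)
    then have "v * 1 \<le> v * (v * prob (\<Union>i\<in>I. A i) / m\<^sup>2)" by simp
    then have "1 \<le> v * prob (\<Union>i\<in>I. A i) / m\<^sup>2" using 3 by (simp only: mult_le_cancel_left_pos)
    then show ?thesis using 3 by (simp add: field_simps)
  qed
  then show ?thesis by (simp add: m_def v_def)
qed

text \<open>Discontinuities of the distribution function are atoms, and there are only countably
  many. This supplies points at which weak convergence can be evaluated.\<close>

lemma (in real_distribution) exists_isCont_cdf_between:
  assumes "a < b"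
  shows "\<exists>x. a < x \<and> x < b \<and> isCont (cdf M) x"
proof (rule ccontr)
  assume "\<not> ?thesis"
  then have "{a<..<b} \<subseteq> {x. measure M {x} > 0}"
    by (auto simp: isCont_cdf zero_less_measure_iff)
  then have "countable {a<..<b}" using countable_atoms countable_subset by blast
  then show False using assms uncountable_open_interval by blast
qed

text \<open>Each term is at most the increment \<open>ln ((n + 1) / n)\<close> of the logarithm, and
  the increments telescope.\<close>

lemma sum_inverse_le_ln:
  assumes "1 \<le> d" "d \<le> n"
  shows "(\<Sum>i\<in>{d..<n}. 1 / real (1 + i)) \<le> ln (n / d)"
  using assms(2)
proof (induction n rule: dec_induct)
  case base
  then show ?case using assms(1) by simp
next
  case (step n)
  have n: "0 < real n" "0 < real d" using step assms(1) by auto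
  have "ln (n / Suc n) \<le> n / Suc n - 1" using n by (intro ln_le_minus_one) simp
  then have "1 / real (1 + n) \<le> ln (Suc n / n)" using n by (simp add: ln_div field_simps)
  moreover have "ln (Suc n / d) = ln (n / d) + ln (Suc n / n)" using n by (simp add: ln_div)
  ultimately show ?case using step by simp
qed

text \<open>Each term is at most twice an increment of the square root. Hence the average of
  \<open>sqrt (n / d)\<close> over \<open>d\<close> in \<open>{1..n}\<close> is at most 2.\<close>

lemma sum_inverse_sqrt_le: "(\<Sum>d\<in>{1..n}. 1 / sqrt (real d)) \<le> 2 * sqrt (real n)"
proof (induction n)
  case (Suc n)
  let ?a = "sqrt (real n)" and ?b = "sqrt (real (Suc n))"
  have b: "0 < ?b" by simp
  have "1 = (?b - ?a) * (?b + ?a)" by (simp add: algebra_simps)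
  also have "\<dots> \<le> (?b - ?a) * (2 * ?b)" by (intro mult_left_mono) auto
  finally have "1 / ?b \<le> 2 * ?b - 2 * ?a" using b by (simp add: field_simps)
  with Suc show ?case by simp
qed simp

text \<open>The sum is the harmonic number \<open>harm m\<close> without its first term. The offset
  2 matches the points \<open>(q + 2) * (n / m)\<close> at which \<open>f\<close> is evaluated when
  cells are covered.\<close>

lemma sum_inverse_ge_ln:
  assumes "2 \<le> m"
  shows "ln (real m) - 1 < (\<Sum>q<m - 1. 1 / real (q + 2))"
proof -
  have "ln (real m) < ln (real m + 1)" using assms by simp
  also have "\<dots> \<le> harm m" by (rule ln_le_harm)
  also have "harm m = (\<Sum>i<m. 1 / real (Suc i))"
    unfolding harm_def
    by (rule sum.reindex_bij_witness[where i = Suc and j = "\<lambda>i. i - 1"]) (auto simp: inverse_eq_divide)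
  also have "\<dots> = 1 + (\<Sum>q<m - 1. 1 / real (q + 2))"
    using assms by (cases m) (simp_all add: sum.lessThan_Suc_shift del: sum.lessThan_Suc)
  finally show ?thesis by simp
qed

lemma ereal_limsup_bounded:
  fixes u :: "nat \<Rightarrow> ereal"
  assumes "limsup u < \<infinity>"
  obtains b :: real where "0 < b" "eventually (\<lambda>n. u n < ereal b) sequentially"
proof -
  obtain k :: nat where "limsup u < ereal (real k)"
    using assms less_PInf_Ex_of_nat[of "limsup u"] by auto
  then have "limsup u < ereal (real k + 1)" by (rule less_trans) simp
  then show ?thesis using that[of "real k + 1"] Limsup_lessD[of sequentially u] by simp
qed

lemma one_minus_power_le_exp:
  fixes p :: real
  assumes "p \<le> 1"
  shows "(1 - p) ^ k \<le> exp (- (k * p))"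
proof -
  have "(1 - p) ^ k \<le> exp (- p) ^ k"
    using assms exp_ge_add_one_self[of "- p"] by (intro power_mono) auto
  then show ?thesis by (simp add: exp_of_nat_mult[symmetric])
qed

section \<open>Covering a fixed circle\<close>

locale circle_covering = prob_space M for M :: "'a measure" +
  fixes R :: "nat \<Rightarrow> 'a \<Rightarrow> nat" and U :: "nat \<Rightarrow> 'a \<Rightarrow> nat" and E :: "nat \<Rightarrow> 'a \<Rightarrow> real"
    and f :: "real \<Rightarrow> real" and n :: nat
  assumes n_pos: "1 \<le> n"
    and R_meas [measurable]: "\<And>k. R k \<in> measurable M (count_space UNIV)"
    and R_ident: "\<And>k. distr M (count_space UNIV) (R k) = distr M (count_space UNIV) (R 0)"
    and U_range: "\<And>k \<omega>. \<omega> \<in> space M \<Longrightarrow> U k \<omega> < n"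
    and U_unif: "\<And>k j. j < n \<Longrightarrow> measure M {\<omega> \<in> space M. U k \<omega> = j} = 1 / real n"
    and E_exp: "\<And>k. distributed M lborel (E k) (exponential_density 1)"
    and indep: "indep_vars (\<lambda>_. borel)
         (\<lambda>i \<omega>. case i of Inl k \<Rightarrow> real (R k \<omega>)
                         | Inr (Inl k) \<Rightarrow> real (U k \<omega>)
                         | Inr (Inr k) \<Rightarrow> E k \<omega>) UNIV"
    and f_def: "\<And>r. f r = measure M {\<omega> \<in> space M. r \<le> real (R 0 \<omega>)}"
begin

section \<open>Measurability, independence and the law of the arcs\<close>

lemma U_meas [measurable]: "U k \<in> measurable M (count_space UNIV)"
proof -
  have "(\<lambda>\<omega>. real (U k \<omega>)) \<in> borel_measurable M"
    using indep unfolding indep_vars_def2 by (auto dest!: spec[where x = "Inr (Inl k)"])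
  then have "(\<lambda>\<omega>. nat \<lfloor>real (U k \<omega>)\<rfloor>) \<in> measurable M (count_space UNIV)"
    by measurable
  then show ?thesis by simp
qed

lemma E_meas [measurable]: "E k \<in> borel_measurable M"
  using distributed_measurable[OF E_exp, of k] by simp

lemma indep_E: "indep_vars (\<lambda>_. borel) E UNIV"
proof -
  let ?X = "\<lambda>i \<omega>. case i of Inl k \<Rightarrow> real (R k \<omega>) | Inr (Inl k) \<Rightarrow> real (U k \<omega>) | Inr (Inr k) \<Rightarrow> E k \<omega>"
  have "indep_vars (\<lambda>j. PiM {Inr (Inr j)} (\<lambda>_. borel)) (\<lambda>j \<omega>. restrict (\<lambda>i. ?X i \<omega>) {Inr (Inr j)}) UNIV"
    by (rule indep_vars_restrict[OF indep]) (auto simp: disjoint_family_on_def)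
  then have "indep_vars (\<lambda>_. borel) (\<lambda>j \<omega>. (restrict (\<lambda>i. ?X i \<omega>) {Inr (Inr j)}) (Inr (Inr j))) UNIV"
    by (rule indep_vars_compose2) (auto intro: measurable_component_singleton)
  then show ?thesis by simp
qed

text \<open>Functions of disjoint blocks of independent variables are independent. The blocks
  collect the two coordinates of arc \<open>j\<close>, and the floors recover the natural numbers
  from their real images.\<close>

lemma indep_UR: "indep_vars (\<lambda>_. count_space UNIV) (\<lambda>j \<omega>. (U j \<omega>, R j \<omega>)) UNIV"
proof -
  let ?X = "\<lambda>i \<omega>. case i of Inl k \<Rightarrow> real (R k \<omega>) | Inr (Inl k) \<Rightarrow> real (U k \<omega>) | Inr (Inr k) \<Rightarrow> E k \<omega>"
  let ?K = "\<lambda>j. {Inl j, Inr (Inl j)} :: (nat + nat + nat) set"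
  let ?h = "\<lambda>j g :: (nat + nat + nat) \<Rightarrow> real. (nat \<lfloor>g (Inr (Inl j))\<rfloor>, nat \<lfloor>g (Inl j)\<rfloor>)"
  have "indep_vars (\<lambda>j. PiM (?K j) (\<lambda>_. borel)) (\<lambda>j \<omega>. restrict (\<lambda>i. ?X i \<omega>) (?K j)) UNIV"
    by (rule indep_vars_restrict[OF indep]) (auto simp: disjoint_family_on_def)
  then have "indep_vars (\<lambda>_. count_space UNIV) (\<lambda>j \<omega>. ?h j (restrict (\<lambda>i. ?X i \<omega>) (?K j))) UNIV"
  proof (rule indep_vars_compose2)
    fix j
    have [measurable]: "(\<lambda>g. g (Inl j)) \<in> borel_measurable (PiM (?K j) (\<lambda>_. borel))"
      "(\<lambda>g. g (Inr (Inl j))) \<in> borel_measurable (PiM (?K j) (\<lambda>_. borel))"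
      by (auto intro: measurable_component_singleton)
    show "?h j \<in> measurable (PiM (?K j) (\<lambda>_. borel)) (count_space UNIV)" by measurable
  qed
  then show ?thesis by simp
qed

lemma prob_R: "prob {\<omega> \<in> space M. Q (R k \<omega>)} = prob {\<omega> \<in> space M. Q (R 0 \<omega>)}"
proof -
  have "prob {\<omega> \<in> space M. Q (R k \<omega>)} = measure (distr M (count_space UNIV) (R k)) {r. Q r}" for k
    by (subst measure_distr) (auto intro!: arg_cong[where f = prob])
  then show ?thesis by (simp add: R_ident[of k])
qed

lemma prob_U_R:
  assumes "u < n"
  shows "prob {\<omega> \<in> space M. U j \<omega> = u \<and> Q (R j \<omega>)} = prob {\<omega> \<in> space M. Q (R 0 \<omega>)} / n"
proof -
  let ?X = "\<lambda>i \<omega>. case i of Inl k \<Rightarrow> real (R k \<omega>) | Inr (Inl k) \<Rightarrow> real (U k \<omega>) | Inr (Inr k) \<Rightarrow> E k \<omega>"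
  let ?A = "\<lambda>i :: nat + nat + nat. case i of Inl k \<Rightarrow> real ` {r. Q r} | _ \<Rightarrow> {real u}"
  have cl: "real ` {r. Q r} \<in> sets borel"
    by (intro borel_closed closed_of_nat_image)
  have "prob (\<Inter>i\<in>{Inl j, Inr (Inl j)}. ?X i -` ?A i \<inter> space M)
      = (\<Prod>i\<in>{Inl j, Inr (Inl j)}. prob (?X i -` ?A i \<inter> space M))"
    using cl by (intro indep_varsD[OF indep]) auto
  also have "(\<Inter>i\<in>{Inl j, Inr (Inl j)}. ?X i -` ?A i \<inter> space M) = {\<omega> \<in> space M. U j \<omega> = u \<and> Q (R j \<omega>)}"
    by auto
  also have "(\<Prod>i\<in>{Inl j, Inr (Inl j)}. prob (?X i -` ?A i \<inter> space M))
     = prob {\<omega> \<in> space M. Q (R j \<omega>)} * prob {\<omega> \<in> space M. U j \<omega> = u}"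
    by (auto intro!: arg_cong2[where f = "(*)"] arg_cong[where f = prob])
  finally show ?thesis using U_unif[OF assms] prob_R[of Q j] by simp
qed

lemma prob_arc:
  "prob {\<omega> \<in> space M. Q (U j \<omega>) (R j \<omega>)} = (\<Sum>u<n. prob {\<omega> \<in> space M. Q u (R 0 \<omega>)}) / n"
proof -
  have "{\<omega> \<in> space M. Q (U j \<omega>) (R j \<omega>)} = (\<Union>u\<in>{..<n}. {\<omega> \<in> space M. U j \<omega> = u \<and> Q u (R j \<omega>)})"
    using U_range by auto
  also have "prob \<dots> = (\<Sum>u<n. prob {\<omega> \<in> space M. U j \<omega> = u \<and> Q u (R j \<omega>)})"
    by (rule finite_measure_finite_Union) (auto simp: disjoint_family_on_def)
  also have "\<dots> = (\<Sum>u<n. prob {\<omega> \<in> space M. Q u (R 0 \<omega>)} / n)"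
    by (intro sum.cong refl) (subst prob_U_R, auto)
  finally show ?thesis by (simp add: sum_divide_distrib)
qed

text \<open>The arcs are independent, and conditioning on the uniform start gives the average over
  \<open>u\<close>. The probabilities of all covering events below are computed from this
  formula.\<close>

lemma prob_all_arcs:
  "prob {\<omega> \<in> space M. \<forall>j<k. Q (U j \<omega>) (R j \<omega>)}
     = ((\<Sum>u<n. prob {\<omega> \<in> space M. Q u (R 0 \<omega>)}) / n) ^ k"
proof (cases "k = 0")
  case True
  then show ?thesis by (simp add: prob_space)
next
  case False
  let ?A = "{p. Q (fst p) (snd p)}"
  have "prob (\<Inter>j\<in>{..<k}. (\<lambda>\<omega>. (U j \<omega>, R j \<omega>)) -` ?A \<inter> space M)
      = (\<Prod>j\<in>{..<k}. prob ((\<lambda>\<omega>. (U j \<omega>, R j \<omega>)) -` ?A \<inter> space M))"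
    using False by (intro indep_varsD[OF indep_UR]) auto
  also have "(\<Inter>j\<in>{..<k}. (\<lambda>\<omega>. (U j \<omega>, R j \<omega>)) -` ?A \<inter> space M)
      = {\<omega> \<in> space M. \<forall>j<k. Q (U j \<omega>) (R j \<omega>)}"
    using False by auto
  also have "(\<Prod>j\<in>{..<k}. prob ((\<lambda>\<omega>. (U j \<omega>, R j \<omega>)) -` ?A \<inter> space M))
      = (\<Prod>j\<in>{..<k}. (\<Sum>u<n. prob {\<omega> \<in> space M. Q u (R 0 \<omega>)}) / n)"
  proof (rule prod.cong[OF refl])
    fix j
    show "prob ((\<lambda>\<omega>. (U j \<omega>, R j \<omega>)) -` ?A \<inter> space M) = (\<Sum>u<n. prob {\<omega> \<in> space M. Q u (R 0 \<omega>)}) / n"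
      unfolding prob_arc[of Q j, symmetric] by (rule arg_cong[where f = prob]) auto
  qed
  finally show ?thesis by simp
qed

section \<open>Cover time against the number of arcs\<close>

definition T :: "'a \<Rightarrow> real" where
  "T \<omega> = cover_time n (\<lambda>j. U j \<omega>) (\<lambda>j. R j \<omega>) (\<lambda>j. E j \<omega>)"

definition full :: "nat \<Rightarrow> 'a \<Rightarrow> bool" where
  "full k \<omega> \<longleftrightarrow> covered n (\<lambda>j. U j \<omega>) (\<lambda>j. R j \<omega>) k = {0..<n}"

text \<open>The arrival time of the \<open>k\<close>-th arc.\<close>

definition S :: "nat \<Rightarrow> 'a \<Rightarrow> real" where
  "S k \<omega> = (\<Sum>i<k. E i \<omega>)"

lemma S_meas [measurable]: "S k \<in> borel_measurable M"
  unfolding S_def by measurable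

lemma pred_U_R [measurable]: "Measurable.pred M (\<lambda>\<omega>. Q (U j \<omega>) (R j \<omega>))"
proof -
  have "(\<lambda>\<omega>. (U j \<omega>, R j \<omega>)) \<in> measurable M (count_space UNIV)"
    using indep_UR unfolding indep_vars_def2 by blast
  then have "(\<lambda>\<omega>. (\<lambda>p. Q (fst p) (snd p)) (U j \<omega>, R j \<omega>)) \<in> measurable M (count_space UNIV)"
    by (rule measurable_compose) simp
  then show ?thesis by simp
qed

lemma full_iff: "full k \<omega> \<longleftrightarrow> (\<forall>x<n. \<exists>j<k. x \<in> arc n (U j \<omega>) (R j \<omega>))"
  using covered_subset[OF n_pos, of "\<lambda>j. U j \<omega>" "\<lambda>j. R j \<omega>" k]
  by (auto simp: full_def covered_def)

lemma full_meas [measurable]: "Measurable.pred M (full k)"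
  unfolding full_iff by measurable

lemma f_le_1: "f r \<le> 1" and f_nonneg: "0 \<le> f r"
  unfolding f_def by auto

lemma f_antimono: "r \<le> s \<Longrightarrow> f s \<le> f r"
  unfolding f_def by (intro finite_measure_mono) auto

lemma prob_R_less: "prob {\<omega> \<in> space M. R 0 \<omega> < r} = 1 - f r"
proof -
  have "{\<omega> \<in> space M. R 0 \<omega> < r} = space M - {\<omega> \<in> space M. real r \<le> real (R 0 \<omega>)}" by auto
  then show ?thesis by (simp add: prob_compl f_def)
qed

lemma long_arc_imp_full:
  assumes "j < k" "n \<le> R j \<omega>" "\<omega> \<in> space M"
  shows "full k \<omega>"
proof -
  have "x \<in> arc n (U j \<omega>) (R j \<omega>)" if "x < n" for x
  proof -
    have "(x + n - U j \<omega>) mod n < n" using n_pos by simp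
    then show ?thesis using assms(2) by (simp add: mem_arc_iff[OF that U_range[OF assms(3)]])
  qed
  then show ?thesis using assms(1) by (auto simp: full_iff)
qed

lemma prob_no_long_arc: "prob {\<omega> \<in> space M. \<forall>j<k. R j \<omega> < n} = (1 - f n) ^ k"
  using prob_all_arcs[of k "\<lambda>u r. r < n"] n_pos by (simp add: prob_R_less)

text \<open>A single arc of length at least \<open>n\<close> covers the circle, so on the event that
  \<open>k\<close> arcs do not cover, all of them are shorter than \<open>n\<close>.\<close>

lemma prob_not_full_le: "prob {\<omega> \<in> space M. \<not> full k \<omega>} \<le> (1 - f n) ^ k"
  unfolding prob_no_long_arc[symmetric]
proof (intro finite_measure_mono subsetI)
  fix \<omega> assume "\<omega> \<in> {\<omega> \<in> space M. \<not> full k \<omega>}"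
  then show "\<omega> \<in> {\<omega> \<in> space M. \<forall>j<k. R j \<omega> < n}"
    using long_arc_imp_full[of _ k \<omega>] by (force simp: not_le[symmetric])
qed measurable

lemma AE_E_nonneg: "AE \<omega> in M. \<forall>i. 0 \<le> E i \<omega>"
proof (subst AE_all_countable, rule allI)
  fix i
  have "prob {\<omega> \<in> space M. 0 < E i \<omega>} = 1"
    using exponential_distributedD_gt[OF E_exp, of 0 i] by simp
  then have "AE \<omega> in M. 0 < E i \<omega>" by (subst (asm) prob_Collect_eq_1) auto
  then show "AE \<omega> in M. 0 \<le> E i \<omega>" by eventually_elim simp
qed

text \<open>Chebyshev's inequality: a sum of \<open>k\<close> unit exponentials is Erlang
  distributed with mean and variance \<open>k\<close>. The shape parameter is \<open>k - 1\<close>,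
  which is why \<open>k = 0\<close> is treated apart.\<close>

lemma prob_S_deviation:
  assumes "0 < a"
  shows "prob {\<omega> \<in> space M. a \<le> \<bar>S k \<omega> - k\<bar>} \<le> k / a\<^sup>2"
proof (cases "k = 0")
  case True
  then show ?thesis using assms by (simp add: S_def)
next
  case False
  have "distributed M lborel (\<lambda>\<omega>. \<Sum>i<k. E i \<omega>) (erlang_density (card {..<k} - 1) 1)"
    using False by (intro exponential_distributed_sum E_exp indep_vars_subset[OF indep_E]) auto
  then have D: "distributed M lborel (S k) (erlang_density (k - 1) 1)" by (simp add: S_def[abs_def])
  have e: "expectation (S k) = k"
    using erlang_ith_moment[OF _ D, of 1] False by (cases k) simp_all
  have v: "variance (S k) = k" using erlang_distributed_variance[OF _ D] False by simp
  show ?thesis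
    using Chebyshev_inequality[of "S k" a] erlang_ith_moment_integrable[OF _ D, of 2] assms
    unfolding v unfolding e by simp
qed

text \<open>Staying below \<open>m\<close> forever forces a deviation of at least
  \<open>k - m\<close> at every \<open>k > m\<close>, and the Chebyshev bound on this tends to
  0.\<close>

lemma AE_S_unbounded: "AE \<omega> in M. \<forall>x. \<exists>k. x < S k \<omega>"
proof -
  have "AE \<omega> in M. \<exists>k. real m < S k \<omega>" for m :: nat
  proof -
    let ?N = "{\<omega> \<in> space M. \<not> (\<exists>k. real m < S k \<omega>)}"
    have "prob ?N \<le> real k / (real k - real m)\<^sup>2" if "m < k" for k
    proof -
      have "prob ?N \<le> prob {\<omega> \<in> space M. real k - real m \<le> \<bar>S k \<omega> - k\<bar>}"
        by (intro finite_measure_mono) (auto simp: not_less intro: order_trans[OF _ abs_ge_minus_self])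
      also have "\<dots> \<le> real k / (real k - real m)\<^sup>2" using that by (intro prob_S_deviation) simp
      finally show ?thesis .
    qed
    then have "eventually (\<lambda>k. prob ?N \<le> real k / (real k - real m)\<^sup>2) sequentially"
      by (intro eventually_mono[OF eventually_gt_at_top[of m]])
    moreover have "(\<lambda>k. real k / (real k - real m)\<^sup>2) \<longlonglongrightarrow> 0" by real_asymp
    ultimately have "prob ?N \<le> 0" by (intro tendsto_lowerbound) auto
    then have "prob ?N = 0" by (simp add: measure_le_0_iff)
    then show ?thesis by (subst (asm) prob_Collect_eq_0) auto
  qed
  then have "AE \<omega> in M. \<forall>m::nat. \<exists>k. real m < S k \<omega>" by (simp add: AE_all_countable)
  then show ?thesis
    by eventually_elim (meson less_trans reals_Archimedean2)
qed

lemma AE_eventually_full: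
  assumes "0 < f n"
  shows "AE \<omega> in M. \<exists>k. full k \<omega>"
proof -
  let ?N = "{\<omega> \<in> space M. \<not> (\<exists>k. full k \<omega>)}"
  have "prob ?N \<le> (1 - f n) ^ k" for k
    by (rule order_trans[OF finite_measure_mono prob_not_full_le[of k]]) auto
  moreover have "(\<lambda>k. (1 - f n) ^ k) \<longlonglongrightarrow> 0"
    using assms f_le_1[of n] by (intro LIMSEQ_power_zero) simp
  ultimately have "prob ?N \<le> 0" by (intro tendsto_lowerbound) auto
  then have "prob ?N = 0" by (simp add: measure_le_0_iff)
  then show ?thesis by (subst (asm) prob_Collect_eq_0) auto
qed

lemma AE_T_bounds:
  assumes "0 < f n"
  shows "AE \<omega> in M. 0 \<le> T \<omega> \<and> (\<forall>k. (full k \<omega> \<longrightarrow> T \<omega> \<le> S k \<omega>) \<and> (\<not> full k \<omega> \<longrightarrow> S k \<omega> \<le> T \<omega>))"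
  using AE_E_nonneg AE_S_unbounded AE_eventually_full[OF assms]
proof eventually_elim
  case (elim \<omega>)
  obtain l where "full l \<omega>" using elim(3) by blast
  then have l: "covered n (\<lambda>j. U j \<omega>) (\<lambda>j. R j \<omega>) l = {0..<n}" by (simp add: full_def)
  show ?case
    using cover_time_bounds[of "\<lambda>j. E j \<omega>", OF _ _ n_pos l] elim
    by (simp add: full_def S_def T_def)
qed

text \<open>The cover time is not assumed measurable, so the two estimates below are stated for the
  set function \<^term>\<open>prob\<close>, which vanishes on sets that are not measurable.\<close>

lemma prob_T_gt:
  assumes f: "0 < f n" and a: "0 < a" and x: "k + a \<le> x"
  shows "prob {\<omega> \<in> space M. x < \<bar>T \<omega>\<bar>} \<le> prob {\<omega> \<in> space M. \<not> full k \<omega>} + k / a\<^sup>2"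
proof -
  let ?A = "{\<omega> \<in> space M. \<not> full k \<omega>}" and ?B = "{\<omega> \<in> space M. a \<le> \<bar>S k \<omega> - k\<bar>}"
  have "prob {\<omega> \<in> space M. x < \<bar>T \<omega>\<bar>} \<le> prob (?A \<union> ?B)"
  proof (rule finite_measure_mono_AE)
    show "AE \<omega> in M. \<omega> \<in> {\<omega> \<in> space M. x < \<bar>T \<omega>\<bar>} \<longrightarrow> \<omega> \<in> ?A \<union> ?B"
      using AE_T_bounds[OF f]
      by eventually_elim (use x in \<open>auto simp: abs_if dest!: spec[where x = k]\<close>)
  qed measurable
  also have "\<dots> \<le> prob ?A + prob ?B" by (intro measure_Un_le) measurable
  also have "prob ?B \<le> k / a\<^sup>2" using a by (rule prob_S_deviation)
  finally show ?thesis by simp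
qed

lemma prob_T_less:
  assumes f: "0 < f n" and a: "0 < a" and x: "x \<le> k - a"
  shows "prob {\<omega> \<in> space M. T \<omega> < x} \<le> prob {\<omega> \<in> space M. full k \<omega>} + k / a\<^sup>2"
proof -
  let ?A = "{\<omega> \<in> space M. full k \<omega>}" and ?B = "{\<omega> \<in> space M. a \<le> \<bar>S k \<omega> - k\<bar>}"
  have "prob {\<omega> \<in> space M. T \<omega> < x} \<le> prob (?A \<union> ?B)"
  proof (rule finite_measure_mono_AE)
    show "AE \<omega> in M. \<omega> \<in> {\<omega> \<in> space M. T \<omega> < x} \<longrightarrow> \<omega> \<in> ?A \<union> ?B"
      using AE_T_bounds[OF f]
      by eventually_elim (use x in \<open>auto simp: abs_if dest!: spec[where x = k]\<close>)
  qed measurable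
  also have "\<dots> \<le> prob ?A + prob ?B" by (intro measure_Un_le) measurable
  also have "prob ?B \<le> k / a\<^sup>2" using a by (rule prob_S_deviation)
  finally show ?thesis by simp
qed

lemma prob_T_negative:
  assumes f: "0 < f n"
  shows "prob {\<omega> \<in> space M. T \<omega> < 0} = 0"
proof -
  have "prob {\<omega> \<in> space M. T \<omega> < 0} \<le> prob {}"
    by (rule finite_measure_mono_AE) (use AE_T_bounds[OF f] in \<open>eventually_elim, auto\<close>)
  then show ?thesis by (simp add: measure_le_0_iff)
qed

section \<open>Upper bound: covering whole cells by single arcs\<close>

text \<open>An arc starting \<open>d\<close> steps before \<open>c\<close> contains the whole cell
  of length \<open>s\<close> at \<open>c\<close> once its length is at least \<open>s + d\<close>.
  If some site is uncovered, no arc does this for its cell; the union bound runs over the at most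
  \<open>2 * m\<close> cell starts in \<open>?C\<close>.\<close>

lemma prob_not_full_cells:
  assumes m: "1 \<le> m" "m \<le> n"
  defines "s \<equiv> n div m"
  shows "prob {\<omega> \<in> space M. \<not> full k \<omega>} \<le> 2 * m * (1 - (\<Sum>d<n. f (real (s + d))) / n) ^ k"
proof -
  have s: "1 \<le> s" using m by (simp add: s_def div_greater_zero_iff Suc_le_eq)
  \<comment> \<open>Rounding \<open>n / m\<close> down may require more than \<open>m\<close> cells
    of length \<open>s\<close>, but never more than \<open>2 * m\<close>.\<close>
  have n2: "n \<le> 2 * m * s"
  proof -
    have "n = m * s + n mod m" by (simp add: s_def)
    moreover have "n mod m < m" using m by simp
    moreover have "m \<le> m * s" using s by simp
    ultimately show ?thesis by linarith
  qed
  let ?B = "\<lambda>c. {\<omega> \<in> space M. \<forall>j<k. R j \<omega> < s + (c + n - U j \<omega>) mod n}"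
  let ?C = "(\<lambda>q. q * s) ` {..<2*m} \<inter> {..<n}"
  have card: "card ?C \<le> 2 * m"
    by (rule order_trans[OF card_mono[of "(\<lambda>q. q * s) ` {..<2*m}"]])
      (auto intro: order_trans[OF card_image_le])
  have pB: "prob (?B c) = (1 - (\<Sum>d<n. f (real (s + d))) / n) ^ k" if "c < n" for c
  proof -
    have "prob (?B c) = ((\<Sum>u<n. prob {\<omega> \<in> space M. R 0 \<omega> < s + (c + n - u) mod n}) / n) ^ k"
      by (rule prob_all_arcs)
    also have "(\<Sum>u<n. prob {\<omega> \<in> space M. R 0 \<omega> < s + (c + n - u) mod n})
       = (\<Sum>u<n. 1 - f (real (s + (c + n - u) mod n)))"
      by (simp only: prob_R_less)
    also have "\<dots> = (\<Sum>d<n. 1 - f (real (s + d)))" using that by (rule sum_shift_mod)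
    also have "\<dots> / n = 1 - (\<Sum>d<n. f (real (s + d))) / n"
      using n_pos by (simp add: sum_subtractf field_simps)
    finally show ?thesis .
  qed
  have "{\<omega> \<in> space M. \<not> full k \<omega>} \<subseteq> (\<Union>c\<in>?C. ?B c)"
  proof
    fix \<omega> assume "\<omega> \<in> {\<omega> \<in> space M. \<not> full k \<omega>}"
    then have \<omega>: "\<omega> \<in> space M" and "\<not> full k \<omega>" by auto
    then obtain x where x: "x < n" "\<And>j. j < k \<Longrightarrow> x \<notin> arc n (U j \<omega>) (R j \<omega>)" by (auto simp: full_iff)
    define c where "c = x div s * s"
    have xc: "x = c + x mod s" by (simp add: c_def)
    have "x div s < 2 * m" using x(1) n2 s by (simp add: less_mult_imp_div_less)
    moreover have "c < n" using x(1) xc by linarith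
    ultimately have C: "c \<in> ?C" unfolding c_def by auto
    \<comment> \<open>The site \<open>x\<close> lies \<open>x mod s < s\<close> steps beyond
      \<open>c\<close>, so an arc missing \<open>x\<close> is shorter than \<open>s\<close> plus its
      distance to \<open>c\<close>.\<close>
    have "R j \<omega> < s + (c + n - U j \<omega>) mod n" if j: "j < k" for j
    proof -
      have "R j \<omega> \<le> (x + n - U j \<omega>) mod n"
        using x(2)[OF j] by (simp add: mem_arc_iff[OF x(1) U_range[OF \<omega>]])
      also have "x + n - U j \<omega> = (c + n - U j \<omega>) + x mod s" using xc U_range[OF \<omega>, of j] by simp
      also have "\<dots> mod n \<le> (c + n - U j \<omega>) mod n + x mod s"
        by (metis mod_add_left_eq mod_less_eq_dividend)
      also have "\<dots> < s + (c + n - U j \<omega>) mod n" using s by simp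
      finally show ?thesis .
    qed
    then show "\<omega> \<in> (\<Union>c\<in>?C. ?B c)" using C \<omega> by blast
  qed
  then have "prob {\<omega> \<in> space M. \<not> full k \<omega>} \<le> prob (\<Union>c\<in>?C. ?B c)"
    by (intro finite_measure_mono) (auto intro!: sets.finite_UN)
  also have "\<dots> \<le> (\<Sum>c\<in>?C. prob (?B c))"
    by (intro finite_measure_subadditive_finite) auto
  also have "\<dots> = card ?C * (1 - (\<Sum>d<n. f (real (s + d))) / n) ^ k" using pB by simp
  also have "\<dots> \<le> real (2 * m) * (1 - (\<Sum>d<n. f (real (s + d))) / n) ^ k"
  proof (intro mult_right_mono)
    have "0 < n" using n_pos by simp
    show "0 \<le> (1 - (\<Sum>d<n. f (real (s + d))) / n) ^ k"
      unfolding pB[OF \<open>0 < n\<close>, symmetric] by (rule measure_nonneg)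
    show "real (card ?C) \<le> real (2 * m)" using card by (simp only: of_nat_le_iff)
  qed
  finally show ?thesis by simp
qed

text \<open>The shifts are grouped into blocks of length \<open>s\<close>. On block \<open>q\<close>
  the argument is at most \<open>(q + 2) * (n / m)\<close>, and monotonicity of \<open>f\<close>
  bounds the block from below; each block is a fraction of at least \<open>1 / (2 * m)\<close> of
  the circle. The new arguments have fixed ratio to \<open>n\<close>, as regular variation
  requires.\<close>

lemma sum_f_blocks_ge:
  assumes m: "2 \<le> m" "m \<le> n"
  shows "(\<Sum>q<m - 1. f (real (q + 2) * (n / m))) / (2 * m) \<le> (\<Sum>d<n. f (real (n div m + d))) / n"
proof -
  define s where "s = n div m"
  have sm: "s * m \<le> n" by (simp add: s_def)
  have s1: "1 \<le> s" using m by (simp add: s_def div_greater_zero_iff Suc_le_eq)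
  have "n = m * s + n mod m" by (simp add: s_def)
  moreover have "n mod m < m" using m by simp
  moreover have "m \<le> m * s" using s1 by simp
  ultimately have "n \<le> 2 * m * s" by linarith
  then have "real n \<le> real (2 * m * s)" by (simp only: of_nat_le_iff)
  then have s2: "1 / (2 * m) \<le> s / n" using m by (simp add: field_simps)
  have s3: "real s \<le> n / m"
    using sm m by (simp add: field_simps flip: of_nat_mult) 
  have "(\<Sum>q<m - 1. f (real (q + 2) * (n / m))) / (2 * m) = (\<Sum>q<m - 1. f (real (q + 2) * (n / m))) * (1 / (2 * m))"
    by simp
  also have "\<dots> \<le> (\<Sum>q<m - 1. f (real (q + 2) * (n / m))) * (s / n)"
    by (intro mult_left_mono s2 sum_nonneg f_nonneg)
  also have "\<dots> = (\<Sum>q<m - 1. real s * f (real (q + 2) * (n / m))) / n"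
    by (simp add: sum_distrib_left sum_divide_distrib mult_ac)
  also have "\<dots> \<le> (\<Sum>q<m - 1. \<Sum>d\<in>{q * s..<q * s + s}. f (real (s + d))) / n"
  proof (intro divide_right_mono sum_mono)
    fix q
    have "f (real (q + 2) * (n / m)) \<le> f (real (s + d))" if "d \<in> {q * s..<q * s + s}" for d
    proof (rule f_antimono)
      have "s + d \<le> (q + 2) * s" using that by auto
      then have "real (s + d) \<le> real (q + 2) * real s" by (metis of_nat_le_iff of_nat_mult)
      also have "\<dots> \<le> real (q + 2) * (n / m)" by (intro mult_left_mono s3) simp
      finally show "real (s + d) \<le> real (q + 2) * (n / m)" .
    qed
    then have "(\<Sum>d\<in>{q * s..<q * s + s}. f (real (q + 2) * (n / m)))
        \<le> (\<Sum>d\<in>{q * s..<q * s + s}. f (real (s + d)))" by (rule sum_mono)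
    then show "real s * f (real (q + 2) * (n / m)) \<le> (\<Sum>d\<in>{q * s..<q * s + s}. f (real (s + d)))"
      by simp
  qed simp
  also have "\<dots> = (\<Sum>d<(m - 1) * s. f (real (s + d))) / n"
    by (subst sum.nat_group) simp
  also have "\<dots> \<le> (\<Sum>d<n. f (real (s + d))) / n"
  proof (intro divide_right_mono sum_mono2)
    have "(m - 1) * s \<le> n" using order_trans[OF mult_le_mono1[OF diff_le_self] sm[unfolded mult.commute[of s]]] .
    then show "{..<(m - 1) * s} \<subseteq> {..<n}" by auto
  qed (auto intro: f_nonneg)
  finally show ?thesis by (simp add: s_def)
qed

section \<open>Lower bound: second moment of the number of uncovered sites\<close>

text \<open>This is the expectation of the positive part of \<open>min R n - d\<close>. In
  particular \<open>H 0 / n\<close> is the probability that one arc covers a given site.\<close>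

definition H :: "nat \<Rightarrow> real" where
  "H d = (\<Sum>i\<in>{d..<n}. f (real (1 + i)))"

lemma H_nonneg: "0 \<le> H d"
  unfolding H_def by (intro sum_nonneg f_nonneg)

lemma sum_f_eq_H: "d \<le> n \<Longrightarrow> (\<Sum>i<d. f (real (1 + i))) = H 0 - H d"
  using sum.atLeastLessThan_concat[of 0 d n "\<lambda>i. f (real (1 + i))"]
  by (simp add: H_def lessThan_atLeast0)

lemma prob_uncovered:
  assumes "x < n"
  shows "prob {\<omega> \<in> space M. \<forall>j<k. x \<notin> arc n (U j \<omega>) (R j \<omega>)} = (1 - H 0 / n) ^ k"
proof -
  have "prob {\<omega> \<in> space M. \<forall>j<k. x \<notin> arc n (U j \<omega>) (R j \<omega>)}
      = ((\<Sum>u<n. prob {\<omega> \<in> space M. x \<notin> arc n u (R 0 \<omega>)}) / n) ^ k"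
    by (rule prob_all_arcs)
  also have "(\<Sum>u<n. prob {\<omega> \<in> space M. x \<notin> arc n u (R 0 \<omega>)})
      = (\<Sum>u<n. 1 - f (real (1 + (x + n - u) mod n)))"
  proof (rule sum.cong[OF refl])
    fix u assume "u \<in> {..<n}"
    then show "prob {\<omega> \<in> space M. x \<notin> arc n u (R 0 \<omega>)} = 1 - f (real (1 + (x + n - u) mod n))"
      using assms unfolding prob_R_less[symmetric] by (simp add: mem_arc_iff not_less less_Suc_eq_le)
  qed
  also have "\<dots> = (\<Sum>d<n. 1 - f (real (1 + d)))" using assms by (rule sum_shift_mod)
  also have "\<dots> / n = 1 - H 0 / n"
    using n_pos by (simp add: sum_subtractf H_def lessThan_atLeast0 diff_divide_distrib)
  finally show ?thesis .
qed

text \<open>An arc starting \<open>a\<close> steps before \<open>x\<close> misses both \<open>x\<close> and \<open>y\<close> iff its length is at most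
  \<^term>\<open>min a ((a + d) mod n)\<close>; the modulus wraps around exactly for \<open>a \<ge> n - d\<close>.\<close>

lemma prob_uncovered_pair:
  assumes x: "x < n" and y: "y < n"
  defines "d \<equiv> (y + n - x) mod n"
  defines "p \<equiv> 1 - 2 * H 0 / n + (H d + H (n - d)) / n"
  shows "prob {\<omega> \<in> space M. (\<forall>j<k. x \<notin> arc n (U j \<omega>) (R j \<omega>)) \<and> (\<forall>j<k. y \<notin> arc n (U j \<omega>) (R j \<omega>))} = p ^ k"
    and "0 \<le> p"
proof -
  have d: "d < n" using x by (simp add: d_def)
  let ?g = "\<lambda>a. 1 - f (real (1 + min a ((a + d) mod n)))"
  have e: "(\<Sum>u<n. prob {\<omega> \<in> space M. x \<notin> arc n u (R 0 \<omega>) \<and> y \<notin> arc n u (R 0 \<omega>)})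
      = (\<Sum>u<n. ?g ((x + n - u) mod n))"
  proof (rule sum.cong[OF refl])
    fix u assume u: "u \<in> {..<n}"
    have "((x + n - u) mod n + d) mod n = ((x + n - u) + (y + n - x)) mod n"
      unfolding d_def by (rule mod_add_eq)
    also have "(x + n - u) + (y + n - x) = (y + n - u) + n" using x u by simp
    also have "\<dots> mod n = (y + n - u) mod n" by simp
    finally have *: "((x + n - u) mod n + d) mod n = (y + n - u) mod n" .
    show "prob {\<omega> \<in> space M. x \<notin> arc n u (R 0 \<omega>) \<and> y \<notin> arc n u (R 0 \<omega>)} = ?g ((x + n - u) mod n)"
      using x y u unfolding prob_R_less[symmetric] *
      by (simp add: mem_arc_iff not_less less_Suc_eq_le)
  qed
  also have "\<dots> = (\<Sum>a<n. ?g a)" using x by (rule sum_shift_mod)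
  also have "\<dots> = n - (\<Sum>a<n. f (real (1 + min a ((a + d) mod n))))"
    by (simp add: sum_subtractf)
  also have "(\<Sum>a<n. f (real (1 + min a ((a + d) mod n)))) =
      (\<Sum>a\<in>{0..<n - d}. f (real (1 + min a ((a + d) mod n)))) + (\<Sum>a\<in>{n - d..<n}. f (real (1 + min a ((a + d) mod n))))"
    by (subst sum.atLeastLessThan_concat) (auto simp: lessThan_atLeast0)
  also have "(\<Sum>a\<in>{0..<n - d}. f (real (1 + min a ((a + d) mod n)))) = (\<Sum>a<n - d. f (real (1 + a)))"
    by (rule sum.cong) auto
  also have "(\<Sum>a\<in>{n - d..<n}. f (real (1 + min a ((a + d) mod n)))) = (\<Sum>b<d. f (real (1 + b)))"
  proof (rule sum.reindex_bij_witness[where i = "\<lambda>b. b + (n - d)" and j = "\<lambda>a. a - (n - d)"])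
    fix a assume a: "a \<in> {n - d..<n}"
    then have "(a + d) mod n = a + d - n" using d by (subst mod_if) auto
    then show "f (real (1 + (a - (n - d)))) = f (real (1 + min a ((a + d) mod n)))"
      using a d by (auto intro!: arg_cong[where f = f] simp: min_def)
  qed (use d in auto)
  also have "real n - ((\<Sum>a<n - d. f (real (1 + a))) + (\<Sum>b<d. f (real (1 + b)))) = n * p"
    unfolding sum_f_eq_H[OF diff_le_self] sum_f_eq_H[OF less_imp_le[OF d]]
    using n_pos by (simp add: p_def field_simps)
  finally have sum: "(\<Sum>u<n. prob {\<omega> \<in> space M. x \<notin> arc n u (R 0 \<omega>) \<and> y \<notin> arc n u (R 0 \<omega>)}) = n * p" .
  have "0 \<le> n * p" unfolding sum[symmetric] by (intro sum_nonneg) auto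
  then show "0 \<le> p" using n_pos by (simp add: zero_le_mult_iff)
  have "{\<omega> \<in> space M. (\<forall>j<k. x \<notin> arc n (U j \<omega>) (R j \<omega>)) \<and> (\<forall>j<k. y \<notin> arc n (U j \<omega>) (R j \<omega>))}
      = {\<omega> \<in> space M. \<forall>j<k. x \<notin> arc n (U j \<omega>) (R j \<omega>) \<and> y \<notin> arc n (U j \<omega>) (R j \<omega>)}" by auto
  then show "prob {\<omega> \<in> space M. (\<forall>j<k. x \<notin> arc n (U j \<omega>) (R j \<omega>)) \<and> (\<forall>j<k. y \<notin> arc n (U j \<omega>) (R j \<omega>))} = p ^ k"
    using prob_all_arcs[of k "\<lambda>u r. x \<notin> arc n u r \<and> y \<notin> arc n u r"] sum n_pos by simp
qed

text \<open>\<open>second_moment_Union\<close> is applied to the events that a site is uncovered.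
  Dividing by the squared mean leaves a correlation factor for each distance \<open>d\<close>, and
  the sum of these factors controls the estimate.\<close>

lemma prob_not_full_ge:
  assumes half: "H 0 / n \<le> 1 / 2"
  shows "n \<le> prob {\<omega> \<in> space M. \<not> full k \<omega>} * (\<Sum>d\<le>n. exp (8 * k * H d / n))"
proof -
  let ?A = "\<lambda>x. {\<omega> \<in> space M. \<forall>j<k. x \<notin> arc n (U j \<omega>) (R j \<omega>)}"
  define q where "q = 1 - H 0 / n"
  define W where "W = (\<Sum>d\<le>n. exp (8 * k * H d / n))"
  let ?G = "\<lambda>d. (H d + H (n - d)) / n"
  let ?p = "\<lambda>d. 1 - 2 * H 0 / n + ?G d"
  have q: "1 / 2 \<le> q" using half by (simp add: q_def)
  have q2: "1 \<le> 4 * q\<^sup>2" using power_mono[OF q, of 2] by (simp add: power2_eq_square)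
  have un: "(\<Union>x\<in>{..<n}. ?A x) = {\<omega> \<in> space M. \<not> full k \<omega>}" by (auto simp: full_iff)
  have inter: "prob (?A y \<inter> ?A x) = ?p ((y + n - x) mod n) ^ k" if "x < n" "y < n" for x y
    unfolding prob_uncovered_pair(1)[OF that, symmetric] by (rule arg_cong[where f = prob]) auto
  have p0: "0 \<le> ?p d" if "d < n" for d
    using prob_uncovered_pair(2)[of 0 d] that n_pos by simp
  have pk: "?p d ^ k \<le> (q ^ k)\<^sup>2 * exp (4 * k * ?G d)" if "d < n" for d
  proof -
    have G: "0 \<le> ?G d" by (simp add: H_nonneg)
    \<comment> \<open>The square \<open>q\<^sup>2\<close> exceeds \<open>1 - 2 * H 0 / n\<close> by
      \<open>(H 0 / n)\<^sup>2\<close>; then \<open>1 \<le> 4 * q\<^sup>2\<close> turns the additive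
      correction \<open>?G d\<close> into a factor.\<close>
    have "?p d \<le> q\<^sup>2 + ?G d" by (simp add: q_def power2_eq_square algebra_simps)
    also have "\<dots> \<le> q\<^sup>2 + 4 * q\<^sup>2 * ?G d" using mult_right_mono[OF q2 G] by simp
    also have "\<dots> = q\<^sup>2 * (1 + 4 * ?G d)" by (simp add: algebra_simps)
    also have "\<dots> \<le> q\<^sup>2 * exp (4 * ?G d)" by (intro mult_left_mono exp_ge_add_one_self) simp
    finally have "?p d ^ k \<le> (q\<^sup>2 * exp (4 * ?G d)) ^ k" using p0[OF that] by (intro power_mono)
    also have "\<dots> = (q ^ k)\<^sup>2 * exp (4 * k * ?G d)"
      by (simp add: power_mult_distrib exp_of_nat_mult[symmetric] power_mult[symmetric] mult_ac)
    finally show ?thesis .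
  qed
  \<comment> \<open>The arithmetic-geometric mean inequality separates \<open>H d\<close> from
    \<open>H (n - d)\<close>, so that the reflection \<open>d\<close> to \<open>n - d\<close>
    reduces both to one sum.\<close>
  have expG: "exp (4 * k * ?G d) \<le> (exp (8 * k * H d / n) + exp (8 * k * H (n - d) / n)) / 2" for d
  proof -
    let ?a = "exp (4 * k * H d / n)" and ?b = "exp (4 * k * H (n - d) / n)"
    have "exp (4 * k * ?G d) = ?a * ?b"
      by (simp add: exp_add[symmetric] add_divide_distrib distrib_left)
    also have "\<dots> \<le> (?a\<^sup>2 + ?b\<^sup>2) / 2" using sum_squares_bound[of ?a ?b] by simp
    also have "?a\<^sup>2 = exp (8 * k * H d / n)"
      by (simp add: power2_eq_square exp_add[symmetric])
    also have "?b\<^sup>2 = exp (8 * k * H (n - d) / n)"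
      by (simp add: power2_eq_square exp_add[symmetric])
    finally show ?thesis .
  qed
  have sumG: "(\<Sum>d<n. exp (4 * k * ?G d)) \<le> W"
  proof -
    have "(\<Sum>d<n. exp (4 * k * ?G d))
        \<le> (\<Sum>d<n. (exp (8 * k * H d / n) + exp (8 * k * H (n - d) / n)) / 2)"
      by (intro sum_mono expG)
    also have "\<dots> = ((\<Sum>d<n. exp (8 * k * H d / n)) + (\<Sum>d<n. exp (8 * k * H (n - d) / n))) / 2"
      by (simp add: sum_divide_distrib[symmetric] sum.distrib)
    also have "(\<Sum>d<n. exp (8 * k * H (n - d) / n)) = (\<Sum>d\<in>{1..n}. exp (8 * k * H d / n))"
      by (rule sum.reindex_bij_witness[where i = "\<lambda>d. n - d" and j = "\<lambda>d. n - d"]) auto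
    also have "\<dots> \<le> W" unfolding W_def by (intro sum_mono2) auto
    also have "(\<Sum>d<n. exp (8 * k * H d / n)) \<le> W" unfolding W_def by (intro sum_mono2) auto
    finally show ?thesis by simp
  qed
  have "(n * q ^ k)\<^sup>2 = (\<Sum>x<n. prob (?A x))\<^sup>2"
    by (simp add: prob_uncovered q_def)
  also have "\<dots> \<le> prob (\<Union>x\<in>{..<n}. ?A x) * (\<Sum>y<n. \<Sum>x<n. prob (?A y \<inter> ?A x))"
    by (rule second_moment_Union) auto
  also have "(\<Sum>y<n. \<Sum>x<n. prob (?A y \<inter> ?A x)) = (\<Sum>y<n. \<Sum>x<n. ?p ((y + n - x) mod n) ^ k)"
    by (intro sum.cong refl inter) auto
  also have "\<dots> = (\<Sum>y<n. \<Sum>d<n. ?p d ^ k)"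
    by (rule sum.cong[OF refl], rule sum_shift_mod) simp
  also have "\<dots> = n * (\<Sum>d<n. ?p d ^ k)" by simp
  also have "(\<Sum>d<n. ?p d ^ k) \<le> (\<Sum>d<n. (q ^ k)\<^sup>2 * exp (4 * k * ?G d))"
    using pk by (intro sum_mono) simp
  also have "\<dots> = (q ^ k)\<^sup>2 * (\<Sum>d<n. exp (4 * k * ?G d))" by (simp add: sum_distrib_left)
  also have "\<dots> \<le> (q ^ k)\<^sup>2 * W" by (intro mult_left_mono sumG) simp
  finally have "(n * q ^ k)\<^sup>2 \<le> prob (\<Union>x\<in>{..<n}. ?A x) * (n * ((q ^ k)\<^sup>2 * W))"
    by (simp add: mult_left_mono)
  then have "(n * (q ^ k)\<^sup>2) * n \<le> (n * (q ^ k)\<^sup>2) * (prob {\<omega> \<in> space M. \<not> full k \<omega>} * W)"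
    unfolding un by (simp add: power2_eq_square mult_ac)
  moreover have "0 < n * (q ^ k)\<^sup>2" using q n_pos by simp
  ultimately show ?thesis unfolding W_def by (simp only: mult_le_cancel_left_pos of_nat_mult of_nat_numeral)
qed

lemma H_antimono: "d \<le> e \<Longrightarrow> H e \<le> H d"
  unfolding H_def by (intro sum_mono2 f_nonneg) auto

text \<open>The first \<open>l\<close> terms are at most 1 and the later ones at most
  \<open>f l\<close>. For fixed large \<open>l\<close> this keeps the covering probability of a
  single arc small compared to 1.\<close>

lemma H_0_le:
  assumes "l \<le> n"
  shows "H 0 \<le> l + n * f l"
proof -
  have "H 0 = (\<Sum>i<l. f (real (1 + i))) + H l" using sum_f_eq_H[OF assms] by simp
  also have "(\<Sum>i<l. f (real (1 + i))) \<le> (\<Sum>i<l. 1)" by (intro sum_mono f_le_1)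
  also have "H l \<le> (\<Sum>i\<in>{l..<n}. f l)" unfolding H_def by (intro sum_mono f_antimono) auto
  also have "(\<Sum>i\<in>{l..<n}. f l) = (n - l) * f l" by simp
  also have "\<dots> \<le> n * f l" by (intro mult_right_mono f_nonneg) simp
  finally show ?thesis by simp
qed

text \<open>Every argument \<open>1 + i\<close> lies between \<open>sqrt n\<close> and
  \<open>n\<close>, so each term is at most a multiple of \<open>1 / (1 + i)\<close> and the
  harmonic sum gives the logarithm.\<close>

lemma H_le_ln:
  assumes d: "1 \<le> d" "d \<le> n" "sqrt n \<le> real (1 + d)"
    and b: "\<And>x. sqrt n \<le> x \<Longrightarrow> x \<le> n \<Longrightarrow> x * f x \<le> b * (n * f n)"
  shows "H d \<le> b * (n * f n) * ln (n / d)"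
proof -
  have b0: "0 \<le> b * (n * f n)"
  proof -
    have "sqrt n * 1 \<le> sqrt n * sqrt n" using n_pos by (intro mult_left_mono) auto
    then have "sqrt n \<le> n" by simp
    from b[OF this] f_nonneg[of n] show ?thesis by (meson mult_nonneg_nonneg of_nat_0_le_iff order_refl order_trans)
  qed
  have "H d \<le> (\<Sum>i\<in>{d..<n}. b * (n * f n) * (1 / real (1 + i)))"
    unfolding H_def
  proof (rule sum_mono)
    fix i assume i: "i \<in> {d..<n}"
    have "real (1 + i) * f (real (1 + i)) \<le> b * (n * f n)"
      using i d by (intro b) auto
    then show "f (real (1 + i)) \<le> b * (n * f n) * (1 / real (1 + i))"
      by (simp add: field_simps)
  qed
  also have "\<dots> = b * (n * f n) * (\<Sum>i\<in>{d..<n}. 1 / real (1 + i))" by (simp add: sum_distrib_left)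
  also have "\<dots> \<le> b * (n * f n) * ln (n / d)"
    using d b0 by (intro mult_left_mono sum_inverse_le_ln)
  finally show ?thesis .
qed

text \<open>The correlation factors sum to at most \<open>3 * n\<close>: fewer than
  \<open>sqrt n + 1\<close> near distances contribute at most \<open>sqrt n\<close> each, for a
  total of at most \<open>n\<close>, and the far ones contribute \<open>sqrt (n / d)\<close>, for a
  total of at most \<open>2 * n\<close>.\<close>

lemma prob_not_full_ge_third:
  assumes half: "H 0 / n \<le> 1 / 2"
    and b: "\<And>x. sqrt n \<le> x \<Longrightarrow> x \<le> n \<Longrightarrow> x * f x \<le> b * (n * f n)"
    and r: "r = nat \<lfloor>sqrt n\<rfloor>"
    and D: "(\<Sum>i = 1..r. f (real i)) \<le> D * (f n * n * ln n)"
    and k: "16 * (k * f n) * (b + D) \<le> 1"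
    and bD: "0 < b" "0 < D"
  shows "1 / 3 \<le> prob {\<omega> \<in> space M. \<not> full k \<omega>}"
proof -
  let ?e = "\<lambda>d. exp (8 * k * H d / n)"
  have sq: "1 \<le> sqrt n" using n_pos by simp
  have rs: "real r \<le> sqrt n" "sqrt n \<le> real (1 + r)" using sq unfolding r by linarith+
  have r1: "1 \<le> r" using sq unfolding r by (simp add: le_nat_floor)
  have "sqrt n * 1 \<le> sqrt n * sqrt n" using sq by (intro mult_left_mono) auto
  then have "sqrt n \<le> n" by simp
  then have rn: "r \<le> n" using rs by linarith
  have fn: "0 \<le> f n" by (rule f_nonneg)
  have kb: "16 * (k * f n) * b \<le> 1"
  proof -
    have "16 * (k * f n) * b \<le> 16 * (k * f n) * (b + D)" using bD fn by (intro mult_left_mono) auto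
    with k show ?thesis by linarith
  qed
  \<comment> \<open>The exponent is \<open>8 * k * f n * b * ln (n / d)\<close>; the constant 16 in
    the bound on \<open>k\<close> makes it at most half the logarithm.\<close>
  have far: "?e d \<le> sqrt n / sqrt d" if d: "r \<le> d" "d \<le> n" for d
  proof -
    have d1: "1 \<le> d" using r1 d by simp
    have ln0: "0 \<le> ln (n / d)" using d d1 by simp
    have "sqrt n \<le> real (1 + d)" using rs d by simp
    from H_le_ln[OF d1 d(2) this b] have "8 * k * H d / n \<le> 8 * k * (b * (n * f n) * ln (n / d)) / n"
      by (intro divide_right_mono mult_left_mono) auto
    also have "\<dots> = (16 * (k * f n) * b) * (ln (n / d) / 2)" using n_pos by simp
    also have "\<dots> \<le> 1 * (ln (n / d) / 2)" using kb ln0 by (intro mult_right_mono) auto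
    finally have "?e d \<le> exp (ln (n / d) / 2)" by simp
    also have "\<dots> = sqrt (n / d)" using d1 n_pos by (simp add: ln_sqrt[symmetric])
    finally show ?thesis by (simp add: real_sqrt_divide)
  qed
  \<comment> \<open>\<open>H 0\<close> is split at \<open>r\<close>: the summation condition bounds
    the lower part, and \<open>H_le_ln\<close> at \<open>r\<close> the upper one.\<close>
  have near: "?e d \<le> sqrt n" for d
  proof -
    have ln0: "0 \<le> ln (real n)" using n_pos by simp
    have "H d \<le> H 0" by (intro H_antimono) simp
    also have "H 0 = (\<Sum>i<r. f (real (1 + i))) + H r" using sum_f_eq_H[OF rn] by simp
    also have "(\<Sum>i<r. f (real (1 + i))) = (\<Sum>i = 1..r. f (real i))"
      by (rule sum.reindex_bij_witness[where i = "\<lambda>i. i - 1" and j = Suc]) auto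
    also note D
    also have "H r \<le> b * (n * f n) * ln (n / r)" using H_le_ln[OF r1 rn rs(2) b] .
    also have "\<dots> \<le> b * (n * f n) * ln n"
      using r1 n_pos bD fn by (intro mult_left_mono) (auto simp: ln_div)
    finally have "H d \<le> (b + D) * (n * f n * ln n)" by (simp add: algebra_simps)
    then have "8 * k * H d / n \<le> 8 * k * ((b + D) * (n * f n * ln n)) / n"
      by (intro divide_right_mono mult_left_mono) auto
    also have "\<dots> = (16 * (k * f n) * (b + D)) * (ln n / 2)" using n_pos by simp
    also have "\<dots> \<le> 1 * (ln n / 2)" using k ln0 by (intro mult_right_mono) auto
    finally have "?e d \<le> exp (ln n / 2)" by simp
    also have "\<dots> = sqrt n" using n_pos by (simp add: ln_sqrt[symmetric])
    finally show ?thesis .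
  qed
  have "(\<Sum>d\<le>n. ?e d) = (\<Sum>d\<in>{0..<r}. ?e d) + (\<Sum>d\<in>{r..<Suc n}. ?e d)"
    using rn by (subst sum.atLeastLessThan_concat) (auto simp: atLeast0LessThan lessThan_Suc_atMost)
  also have "(\<Sum>d\<in>{0..<r}. ?e d) \<le> (\<Sum>d\<in>{0..<r}. sqrt n)" by (intro sum_mono near)
  also have "\<dots> = r * sqrt n" by simp
  also have "\<dots> \<le> sqrt n * sqrt n" using rs(1) by (intro mult_right_mono) auto
  also have "\<dots> = n" by simp
  also have "(\<Sum>d\<in>{r..<Suc n}. ?e d) \<le> (\<Sum>d\<in>{r..<Suc n}. sqrt n / sqrt d)"
    by (intro sum_mono far) auto
  also have "\<dots> \<le> (\<Sum>d\<in>{1..n}. sqrt n / sqrt d)" using r1 by (intro sum_mono2) auto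
  also have "\<dots> = sqrt n * (\<Sum>d\<in>{1..n}. 1 / sqrt d)" by (simp add: sum_distrib_left)
  also have "\<dots> \<le> sqrt n * (2 * sqrt n)" by (intro mult_left_mono sum_inverse_sqrt_le) simp
  also have "\<dots> = 2 * n" by simp
  finally have W: "(\<Sum>d\<le>n. ?e d) \<le> 3 * n" by simp
  have "n \<le> prob {\<omega> \<in> space M. \<not> full k \<omega>} * (\<Sum>d\<le>n. ?e d)"
    using prob_not_full_ge[OF half, of k] by simp
  also have "\<dots> \<le> prob {\<omega> \<in> space M. \<not> full k \<omega>} * (3 * n)" using W by (intro mult_left_mono) auto
  finally have "real n * 1 \<le> real n * (3 * prob {\<omega> \<in> space M. \<not> full k \<omega>})" by (simp add: mult_ac)
  then show ?thesis using n_pos by simp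
qed

end

section \<open>Asymptotics of the cover time\<close>

locale covering_family = prob_space M for M :: "'a measure" +
  fixes R :: "nat \<Rightarrow> 'a \<Rightarrow> nat" and U :: "nat \<Rightarrow> nat \<Rightarrow> 'a \<Rightarrow> nat" and E :: "nat \<Rightarrow> 'a \<Rightarrow> real"
    and f :: "real \<Rightarrow> real"
  assumes covering: "\<And>n. 1 \<le> n \<Longrightarrow> circle_covering M R (U n) E f n"
    and f_RV: "regvar (-1) f"
begin

definition X :: "nat \<Rightarrow> 'a \<Rightarrow> real" where
  "X n \<omega> = f (real n) * cover_time n (\<lambda>k. U n k \<omega>) (\<lambda>k. R k \<omega>) (\<lambda>k. E k \<omega>)"

definition not_full :: "nat \<Rightarrow> nat \<Rightarrow> real" where
  "not_full n k = prob {\<omega> \<in> space M. covered n (\<lambda>j. U n j \<omega>) (\<lambda>j. R j \<omega>) k \<noteq> {0..<n}}"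

lemma f_eq: "f r = prob {\<omega> \<in> space M. r \<le> real (R 0 \<omega>)}"
  by (rule circle_covering.f_def[OF covering[OF order_refl]])

lemma f_le_1: "f r \<le> 1" and f_nonneg: "0 \<le> f r"
  unfolding f_eq by auto

lemma f_antimono: "r \<le> s \<Longrightarrow> f s \<le> f r"
  by (rule circle_covering.f_antimono[OF covering[OF order_refl]])

lemma f_ratio_tendsto: "0 < t \<Longrightarrow> ((\<lambda>x. f (x * t) / f x) \<longlongrightarrow> 1 / t) at_top"
  using f_RV unfolding regvar_def by (auto simp: powr_minus_divide)

text \<open>A zero of the antitone \<open>f\<close> would make it vanish from there on. Since
  \<open>0 / 0 = 0\<close>, the ratio for \<open>t = 1\<close> would then tend to 0 instead of
  1.\<close>

lemma f_pos: "0 < f r"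
proof (rule ccontr)
  assume "\<not> 0 < f r"
  then have "f r = 0" using f_nonneg[of r] by simp
  then have "eventually (\<lambda>x. f (x * 1) / f x = 0) at_top"
    using f_antimono[of r] f_nonneg by (intro eventually_mono[OF eventually_ge_at_top[of r]]) (metis div_0 order_antisym mult_1_right)
  then have "((\<lambda>x. f (x * 1) / f x) \<longlongrightarrow> 0) at_top" by (rule tendsto_eventually)
  with f_ratio_tendsto[of 1] show False
    using tendsto_unique[of "at_top :: real filter"] by fastforce
qed

lemma f_tendsto_0: "(\<lambda>n. f (real n)) \<longlonglongrightarrow> 0"
proof -
  let ?A = "\<lambda>n::nat. {\<omega> \<in> space M. real n \<le> real (R 0 \<omega>)}"
  have [measurable]: "R 0 \<in> measurable M (count_space UNIV)"
    by (rule circle_covering.R_meas[OF covering[OF order_refl]])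
  have "(\<lambda>n. prob (?A n)) \<longlonglongrightarrow> prob (\<Inter>n. ?A n)"
    by (rule finite_Lim_measure_decseq) (auto simp: decseq_def)
  moreover have "(\<Inter>n. ?A n) = {}"
  proof (intro equals0I)
    fix \<omega> assume "\<omega> \<in> (\<Inter>n. ?A n)"
    then have "\<omega> \<in> ?A (Suc (R 0 \<omega>))" by (rule INT_D) simp
    then show False by simp
  qed
  ultimately show ?thesis by (simp add: f_eq)
qed

lemma eventually_f_less: "0 < \<epsilon> \<Longrightarrow> eventually (\<lambda>n::nat. f (real n) < \<epsilon>) sequentially"
  using order_tendstoD(2)[OF f_tendsto_0] .

lemma not_full_le_power: "1 \<le> n \<Longrightarrow> not_full n k \<le> (1 - f n) ^ k"
  using circle_covering.prob_not_full_le[OF covering, of n k]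
  by (simp add: not_full_def circle_covering.full_def[OF covering])

text \<open>On the scale of \<open>X\<close>, \<open>k\<close> arcs take time about
  \<open>k * f n\<close>. The slack \<open>a\<close> allows for fluctuations of the clock and costs
  the Chebyshev term.\<close>

lemma X_tail:
  assumes n: "1 \<le> n" and a: "0 < a" and K: "(k + a) * f n \<le> K"
  shows "prob {\<omega> \<in> space M. K < \<bar>X n \<omega>\<bar>} \<le> not_full n k + k / a\<^sup>2"
proof -
  interpret C: circle_covering M R "U n" E f n using n by (rule covering)
  have "(K < \<bar>X n \<omega>\<bar>) = (K / f n < \<bar>C.T \<omega>\<bar>)" for \<omega>
    using f_pos[of n] by (simp add: X_def C.T_def abs_mult field_simps)
  moreover have "k + a \<le> K / f n" using K f_pos[of n] by (simp add: field_simps)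
  ultimately show ?thesis
    using C.prob_T_gt[OF f_pos a] by (simp add: not_full_def C.full_def)
qed

lemma X_low:
  assumes n: "1 \<le> n" and a: "0 < a" and K: "K \<le> (k - a) * f n"
  shows "prob {\<omega> \<in> space M. X n \<omega> < K} \<le> 1 - not_full n k + k / a\<^sup>2"
proof -
  interpret C: circle_covering M R "U n" E f n using n by (rule covering)
  have "(X n \<omega> < K) = (C.T \<omega> < K / f n)" for \<omega>
    using f_pos[of n] by (simp add: X_def C.T_def field_simps)
  moreover have "K / f n \<le> k - a" using K f_pos[of n] by (simp add: field_simps)
  moreover have "prob {\<omega> \<in> space M. C.full k \<omega>} = 1 - not_full n k"
  proof -
    have "prob {\<omega> \<in> space M. \<not> \<not> C.full k \<omega>} = 1 - prob {\<omega> \<in> space M. \<not> C.full k \<omega>}"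
      by (rule prob_neg) measurable
    then show ?thesis by (simp add: not_full_def C.full_def)
  qed
  ultimately show ?thesis using C.prob_T_less[OF f_pos a, of "K / f n" k] by simp
qed

lemma X_negative:
  assumes n: "1 \<le> n"
  shows "prob {\<omega> \<in> space M. X n \<omega> < 0} = 0"
proof -
  interpret C: circle_covering M R "U n" E f n using n by (rule covering)
  have "(X n \<omega> < 0) = (C.T \<omega> < 0)" for \<omega>
    using f_pos[of n] by (simp add: X_def C.T_def mult_less_0_iff)
  then show ?thesis using C.prob_T_negative[OF f_pos] by simp
qed

section \<open>Tightness and bounds for the scaled cover time\<close>

text \<open>With \<open>k\<close> about \<open>L / f n\<close> arcs, none has length at least
  \<open>n\<close> with probability at most \<open>exp (- L)\<close>. The clock slack
  \<open>L * k\<close> costs at most \<open>1 / L\<close>, uniformly in \<open>n\<close>.\<close>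

lemma tight:
  assumes \<epsilon>: "0 < \<epsilon>"
  shows "\<exists>K. \<forall>n\<ge>1. prob {\<omega> \<in> space M. K < \<bar>X n \<omega>\<bar>} < \<epsilon>"
proof (intro exI allI impI)
  fix n :: nat assume n: "1 \<le> n"
  \<comment> \<open>Here \<open>1 / L = \<epsilon> / (\<epsilon> + 2)\<close>, so two errors of size
    \<open>1 / L\<close> stay below \<open>\<epsilon>\<close>.\<close>
  define L where "L = 1 + 2 / \<epsilon>"
  define k where "k = nat \<lceil>L / f n\<rceil>"
  have L: "1 < L" "1 / L < \<epsilon> / 2" using \<epsilon> by (simp_all add: L_def field_simps)
  have k1: "L / f n \<le> k" unfolding k_def by (rule real_nat_ceiling_ge)
  have "1 \<le> L / f n" using L f_le_1[of n] f_pos[of n] by (simp add: field_simps)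
  then have k0: "1 \<le> real k" using k1 by linarith
  have "0 \<le> L / f n" using \<open>1 \<le> L / f n\<close> by linarith
  then have "k \<le> L / f n + 1" unfolding k_def by linarith
  then have "k * f n \<le> (L / f n + 1) * f n" using f_nonneg by (rule mult_right_mono)
  also have "\<dots> = L + f n" using f_pos[of n] by (simp add: field_simps)
  finally have kf: "k * f n \<le> L + 1" using f_le_1[of n] by linarith
  have fk: "L \<le> k * f n" using k1 f_pos[of n] by (simp add: field_simps)
  have "prob {\<omega> \<in> space M. (1 + L) * (L + 1) < \<bar>X n \<omega>\<bar>} \<le> not_full n k + k / (L * k)\<^sup>2"
  proof (rule X_tail[OF n])
    show "0 < L * k" using L k0 by simp
    have "(k + L * k) * f n = (1 + L) * (k * f n)" by (simp add: algebra_simps)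
    also have "\<dots> \<le> (1 + L) * (L + 1)" using L kf by (intro mult_left_mono) auto
    finally show "(k + L * k) * f n \<le> (1 + L) * (L + 1)" .
  qed
  also have "k / (L * k)\<^sup>2 \<le> 1 / L"
  proof -
    have "k / (L * k)\<^sup>2 = 1 / (L * (L * k))" using k0 by (simp add: power2_eq_square)
    also have "\<dots> \<le> 1 / L" using L k0 mult_mono[of 1 L 1 "real k"] by (intro divide_left_mono) auto
    finally show ?thesis .
  qed
  also have "not_full n k \<le> 1 / L"
  proof -
    have "not_full n k \<le> exp (- (k * f n))"
      using not_full_le_power[OF n, of k] one_minus_power_le_exp[OF f_le_1, of n k] by linarith
    also have "\<dots> \<le> exp (- L)" using fk by simp
    also have "\<dots> = 1 / exp L" by (simp add: exp_minus inverse_eq_divide)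
    also have "\<dots> \<le> 1 / L" using L less_imp_le[OF exp_gt_self[of L]] by (intro divide_left_mono) auto
    finally show ?thesis .
  qed
  finally show "prob {\<omega> \<in> space M. (1 + (1 + 2 / \<epsilon>)) * (1 + 2 / \<epsilon> + 1) < \<bar>X n \<omega>\<bar>} < \<epsilon>"
    using L(2) unfolding L_def by linarith
qed

text \<open>The bound 18 does not depend on \<open>\<epsilon>\<close>, which yields compact support
  of the limits. It is twice 9: at most \<open>9 / f n\<close> arcs are thrown, and the clock slack
  equals their number.\<close>

lemma X_le_18:
  assumes \<epsilon>: "0 < \<epsilon>"
  shows "eventually (\<lambda>n. prob {\<omega> \<in> space M. 18 < \<bar>X n \<omega>\<bar>} \<le> \<epsilon>) sequentially"
proof -
  \<comment> \<open>The number of cells is fixed first, from \<open>\<epsilon>\<close> alone;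
    \<open>n\<close> tends to infinity afterwards.\<close>
  have "(\<lambda>m::nat. 2 * real m * exp (- (4 * (ln (real m) - 1)))) \<longlonglongrightarrow> 0" by real_asymp
  then have "eventually (\<lambda>m::nat. 2 * real m * exp (- (4 * (ln (real m) - 1))) < \<epsilon> / 2) sequentially"
    using \<epsilon> by (intro order_tendstoD(2)) auto
  then obtain m :: nat where m: "2 \<le> m" "2 * real m * exp (- (4 * (ln (real m) - 1))) < \<epsilon> / 2"
    using eventually_happens[OF eventually_conj[OF _ eventually_ge_at_top[of 2]]] by force
  define p where "p n = (\<Sum>d<n. f (real (n div m + d))) / n" for n :: nat
  \<comment> \<open>Regular variation is applied to each of the finitely many terms: the ratio for
    \<open>t = (q + 2) / m\<close> tends to \<open>1 / t\<close>.\<close>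
  have "(\<lambda>n::nat. (\<Sum>q<m - 1. f (real n * (real (q + 2) / m)) / f (real n)) / (2 * m))
      \<longlonglongrightarrow> (\<Sum>q<m - 1. 1 / (real (q + 2) / m)) / (2 * m)"
    using m by (intro tendsto_intros filterlim_compose[OF f_ratio_tendsto filterlim_real_sequentially]) auto
  also have "(\<Sum>q<m - 1. 1 / (real (q + 2) / m)) / (2 * m) = (\<Sum>q<m - 1. 1 / real (q + 2)) / 2"
    using m by (simp add: sum_divide_distrib)
  finally have lim: "(\<lambda>n::nat. (\<Sum>q<m - 1. f (real n * (real (q + 2) / m)) / f (real n)) / (2 * m))
      \<longlonglongrightarrow> (\<Sum>q<m - 1. 1 / real (q + 2)) / 2" .
  have "(ln (real m) - 1) / 2 < (\<Sum>q<m - 1. 1 / real (q + 2)) / 2"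
    using sum_inverse_ge_ln[OF m(1)] by simp
  from order_tendstoD(1)[OF lim this] eventually_ge_at_top[of m]
    eventually_f_less[of "\<epsilon> / 2", OF half_gt_zero[OF \<epsilon>]]
  show ?thesis
  proof eventually_elim
    case (elim n)
    have n: "1 \<le> n" using elim(2) m(1) by simp
    have fn: "0 < f n" by (rule f_pos)
    interpret C: circle_covering M R "U n" E f n using n by (rule covering)
    define k where "k = nat \<lceil>8 / f n\<rceil>"
    have k1: "8 / f n \<le> k" unfolding k_def by (rule real_nat_ceiling_ge)
    have "1 / f n \<le> 8 / f n" "1 \<le> 1 / f n" using fn f_le_1[of n] by (simp_all add: field_simps)
    moreover from this have "k \<le> 8 / f n + 1" unfolding k_def by linarith
    ultimately have k2: "k \<le> 9 / f n" and k0: "1 \<le> real k" and k3: "1 / f n \<le> k" using k1 by linarith+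
    have p0: "0 \<le> p n" unfolding p_def by (intro divide_nonneg_nonneg sum_nonneg f_nonneg) simp
    have p1: "p n \<le> 1"
      using n sum_bounded_above[of "{..<n}" "\<lambda>d. f (real (n div m + d))" 1] f_le_1 by (simp add: p_def)
    have "(ln (real m) - 1) / 2 * f n
        \<le> (\<Sum>q<m - 1. f (real n * (real (q + 2) / m)) / f n) / (2 * m) * f n"
      using elim(1) fn by (intro mult_right_mono) auto
    also have "\<dots> = (\<Sum>q<m - 1. f (real (q + 2) * (n / m))) / (2 * m)"
      using fn by (simp add: sum_divide_distrib[symmetric] mult.commute)
    also have "\<dots> \<le> p n" using C.sum_f_blocks_ge[OF m(1) elim(2)] by (simp add: p_def)
    finally have "(ln (real m) - 1) / 2 \<le> p n / f n" using fn by (simp add: field_simps)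
    then have "4 * (ln (real m) - 1) \<le> 8 / f n * p n" by simp
    also have "\<dots> \<le> k * p n" using k1 p0 by (rule mult_right_mono)
    finally have kp: "4 * (ln (real m) - 1) \<le> k * p n" .
    have "not_full n k \<le> 2 * m * (1 - p n) ^ k"
      using C.prob_not_full_cells[of m k] m elim(2) unfolding not_full_def C.full_def p_def by simp
    also have "\<dots> \<le> 2 * m * exp (- (k * p n))"
      by (intro mult_left_mono one_minus_power_le_exp p1) simp
    also have "\<dots> \<le> 2 * m * exp (- (4 * (ln (real m) - 1)))"
      using kp by (intro mult_left_mono) auto
    finally have nf: "not_full n k \<le> \<epsilon> / 2" using m(2) by linarith
    have "prob {\<omega> \<in> space M. 18 < \<bar>X n \<omega>\<bar>} \<le> not_full n k + k / (real k)\<^sup>2"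
      using k0 k2 fn by (intro X_tail[OF n]) (auto simp: field_simps)
    also have "k / (real k)\<^sup>2 \<le> f n" using k0 k3 fn by (simp add: power2_eq_square field_simps)
    finally show ?case using nf elim(3) by linarith
  qed
qed

text \<open>About \<open>\<delta> / (2 * f n)\<close> arcs already include one of length at least
  \<open>n\<close> with probability bounded below. Measurability is a premise because a lower bound
  cannot tolerate the default value 0 of \<open>prob\<close>.\<close>

lemma X_small_prob:
  assumes \<delta>: "0 < \<delta>"
  shows "\<exists>c>0. eventually (\<lambda>n. X n \<in> borel_measurable M \<longrightarrow> c \<le> prob {\<omega> \<in> space M. X n \<omega> \<le> \<delta>}) sequentially"
proof (intro exI conjI)
  \<comment> \<open>Half of the probability of a long arc; the other half pays for the clock error
    \<open>1 / k\<close>.\<close>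
  define c where "c = (1 - exp (- (\<delta> / 4))) / 2"
  show c: "0 < c" using \<delta> by (simp add: c_def)
  have "eventually (\<lambda>n. f (real n) < min (\<delta> / 4) (c * \<delta> / 4)) sequentially"
    using \<delta> c by (intro eventually_f_less) simp
  then show "eventually (\<lambda>n. X n \<in> borel_measurable M \<longrightarrow> c \<le> prob {\<omega> \<in> space M. X n \<omega> \<le> \<delta>}) sequentially"
    using eventually_ge_at_top[of 1]
  proof eventually_elim
    case (elim n)
    have fn: "0 < f n" by (rule f_pos)
    define k where "k = nat \<lfloor>\<delta> / (2 * f n)\<rfloor>"
    have "0 \<le> \<delta> / (2 * f n)" using \<delta> fn by simp
    then have k1: "k \<le> \<delta> / (2 * f n)" "\<delta> / (2 * f n) < k + 1" unfolding k_def by linarith+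
    have "1 \<le> \<delta> / (4 * f n)" "\<delta> / (2 * f n) = \<delta> / (4 * f n) + \<delta> / (4 * f n)"
      using elim(1) fn by (simp_all add: field_simps)
    then have k2: "\<delta> / (4 * f n) \<le> k" and k0: "0 < real k" using k1 by linarith+
    have kf: "\<delta> / 4 \<le> k * f n" using k2 fn by (simp add: field_simps)
    have "(1 - f n) ^ k \<le> exp (- (k * f n))" by (rule one_minus_power_le_exp[OF f_le_1])
    also have "\<dots> \<le> exp (- (\<delta> / 4))" using kf by simp
    finally have e: "not_full n k \<le> exp (- (\<delta> / 4))" using not_full_le_power[OF elim(2), of k] by linarith
    have "1 / k \<le> c"
    proof -
      have "1 / k \<le> 4 * f n / \<delta>" using k2 k0 \<delta> fn by (simp add: field_simps)
      also have "\<dots> \<le> c" using elim(1) \<delta> by (simp add: field_simps)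
      finally show ?thesis .
    qed
    moreover have "k / (real k)\<^sup>2 = 1 / k" using k0 by (simp add: power2_eq_square)
    moreover have "prob {\<omega> \<in> space M. \<delta> < \<bar>X n \<omega>\<bar>} \<le> not_full n k + k / (real k)\<^sup>2"
      using k1(1) k0 fn by (intro X_tail[OF elim(2)]) (auto simp: field_simps)
    moreover have "not_full n k \<le> 1 - 2 * c" using e by (simp add: c_def field_simps)
    ultimately have tail: "prob {\<omega> \<in> space M. \<delta> < \<bar>X n \<omega>\<bar>} \<le> 1 - c"
      by linarith
    show ?case
    proof
      assume X [measurable]: "X n \<in> borel_measurable M"
      have "1 - prob {\<omega> \<in> space M. X n \<omega> \<le> \<delta>} = prob {\<omega> \<in> space M. \<not> X n \<omega> \<le> \<delta>}"
        by (subst prob_neg) auto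
      also have "\<dots> \<le> prob {\<omega> \<in> space M. \<delta> < \<bar>X n \<omega>\<bar>}"
        by (intro finite_measure_mono) auto
      finally show "c \<le> prob {\<omega> \<in> space M. X n \<omega> \<le> \<delta>}" using tail by linarith
    qed
  qed
qed

text \<open>Both conditions enter at the exponent 1/2, the threshold \<open>sqrt n\<close> between
  near and far sites. A fixed multiple of \<open>1 / f n\<close> arcs then leaves a site uncovered
  with probability at least 1/3.\<close>

lemma X_bounded_away_from_0:
  assumes cond_b: "limsup (\<lambda>n::nat. SUP x \<in> {real n powr (1/2) .. real n}.
                  ereal (x * f x / (real n * f (real n)))) < \<infinity>"
    and cond_d: "limsup (\<lambda>n::nat. ereal ((\<Sum>i = 1..nat \<lfloor>real n powr (1/2)\<rfloor>. f (real i))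
                  / (f (real n) * real n * ln (real n)))) < \<infinity>"
  shows "\<exists>\<delta>>0. eventually (\<lambda>n. prob {\<omega> \<in> space M. X n \<omega> < \<delta>} \<le> 9 / 10) sequentially"
proof -
  obtain b where b: "0 < b" "eventually (\<lambda>n::nat. (SUP x \<in> {real n powr (1/2) .. real n}.
                  ereal (x * f x / (real n * f (real n)))) < ereal b) sequentially"
    using ereal_limsup_bounded[OF cond_b] .
  obtain D where D: "0 < D" "eventually (\<lambda>n::nat. ereal ((\<Sum>i = 1..nat \<lfloor>real n powr (1/2)\<rfloor>. f (real i))
                  / (f (real n) * real n * ln (real n))) < ereal D) sequentially"
    using ereal_limsup_bounded[OF cond_d] .
  \<comment> \<open>Chosen so that \<open>k \<le> 4 * \<delta> / f n\<close> gives exactly the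
    required \<open>16 * (k * f n) * (b + D) \<le> 1\<close>.\<close>
  define \<delta> where "\<delta> = 1 / (64 * (b + D))"
  have \<delta>: "0 < \<delta>" "0 < \<delta> / 10" using b D by (simp_all add: \<delta>_def)
  \<comment> \<open>For \<open>n \<ge> 4 * l\<close> both parts of the bound on \<open>H 0\<close>
    are at most \<open>n / 4\<close>.\<close>
  obtain l where l: "f (real l) < 1 / 4"
    using eventually_happens[OF eventually_f_less[of "1/4"]] by auto
  have "eventually (\<lambda>n. prob {\<omega> \<in> space M. X n \<omega> < \<delta>} \<le> 9 / 10) sequentially"
    using b(2) D(2) eventually_ge_at_top[of 2] eventually_ge_at_top[of "4 * l"]
      eventually_f_less[OF \<delta>(2)]
  proof eventually_elim
    case (elim n)
    have n: "1 \<le> n" using elim(3) by simp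
    have fn: "0 < f n" by (rule f_pos)
    interpret C: circle_covering M R "U n" E f n using n by (rule covering)
    have sqrt: "real n powr (1/2) = sqrt n" by (simp add: powr_half_sqrt)
    have bx: "x * f x \<le> b * (n * f n)" if "sqrt n \<le> x" "x \<le> n" for x
    proof -
      have "ereal (x * f x / (real n * f (real n))) \<le> (SUP x \<in> {real n powr (1/2) .. real n}.
                  ereal (x * f x / (real n * f (real n))))"
        using that by (intro SUP_upper) (simp add: sqrt)
      also note elim(1)
      finally have "x * f x / (n * f n) < b" by simp
      then show ?thesis using n fn by (simp add: divide_less_eq less_imp_le)
    qed
    have Dx: "(\<Sum>i = 1..nat \<lfloor>sqrt n\<rfloor>. f (real i)) \<le> D * (f n * n * ln n)"
    proof -
      have "(\<Sum>i = 1..nat \<lfloor>sqrt n\<rfloor>. f (real i)) / (f n * n * ln n) < D"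
        using elim(2) unfolding sqrt by simp
      moreover have "0 < f n * n * ln n" using elim(3) fn by simp
      ultimately show ?thesis by (simp add: divide_less_eq less_imp_le)
    qed
    have half: "C.H 0 / n \<le> 1 / 2"
    proof -
      have "C.H 0 \<le> l + n * f l" using elim(4) by (intro C.H_0_le) simp
      also have "n * f l \<le> n * (1 / 4)" using l by (intro mult_left_mono) auto
      also have "real l \<le> n / 4" using elim(4) by simp
      finally have "C.H 0 \<le> n / 2" by simp
      then show ?thesis using n by (simp add: field_simps)
    qed
    define k where "k = nat \<lfloor>4 * \<delta> / f n\<rfloor>"
    have "0 \<le> 4 * \<delta> / f n" using \<delta> fn by simp
    then have k1: "k \<le> 4 * \<delta> / f n" "4 * \<delta> / f n < k + 1" unfolding k_def by linarith+
    have "1 \<le> 2 * \<delta> / f n" "10 \<le> \<delta> / f n" using elim(5) fn \<delta> by (simp_all add: field_simps)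
    then have k2: "2 * \<delta> / f n \<le> k" and k3: "20 \<le> real k" using k1(2) by simp_all
    then have k4: "40 \<le> 2 * real k" by simp
    have kf: "k * f n \<le> 4 * \<delta>" "2 * \<delta> \<le> k * f n" using k1(1) k2 fn by (simp_all add: field_simps)
    have "16 * (k * f n) * (b + D) \<le> 16 * (4 * \<delta>) * (b + D)"
      using kf b D by (intro mult_right_mono mult_left_mono) auto
    also have "\<dots> = 1" using b D by (simp add: \<delta>_def)
    finally have "16 * (k * f n) * (b + D) \<le> 1" .
    from C.prob_not_full_ge_third[OF half bx refl Dx this b(1) D(1)]
    have nf: "1 / 3 \<le> not_full n k" by (simp add: not_full_def C.full_def)
    \<comment> \<open>The slack \<open>k / 2\<close> leaves
      \<open>k * f n / 2 \<ge> \<delta>\<close>. Since \<open>k \<ge> 20\<close>, the Chebyshev term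
      is at most 1/5, and 1 - 1/3 + 1/5 is below 9/10.\<close>
    have "prob {\<omega> \<in> space M. X n \<omega> < \<delta>} \<le> 1 - not_full n k + k / (real k / 2)\<^sup>2"
      using k3 kf by (intro X_low[OF n]) (auto simp: algebra_simps)
    also have "k / (real k / 2)\<^sup>2 \<le> 1 / 5" using k3 by (simp add: power2_eq_square field_simps)
    finally show ?case using nf by simp
  qed
  then show ?thesis using \<delta> by blast
qed

section \<open>Subsequential limits\<close>

lemma weak_limit:
  assumes nk: "strict_mono nk" and Y: "real_distribution Y"
    and conv: "weak_conv_m (\<lambda>k. distr M borel (X (nk k))) Y"
    and low: "0 < \<delta>" "eventually (\<lambda>n. prob {\<omega> \<in> space M. X n \<omega> < \<delta>} \<le> 9 / 10) sequentially"
  shows "\<not> (\<exists>c. measure Y {c} = 1)" and "\<exists>K. compact K \<and> measure Y K = 1"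
proof -
  interpret Y: real_distribution Y by (rule Y)
  have sub: "filterlim nk sequentially sequentially" by (rule filterlim_subseq[OF nk])
  have lim: "(\<lambda>k. cdf (distr M borel (X (nk k))) x) \<longlonglongrightarrow> cdf Y x" if "isCont (cdf Y) x" for x
    using conv that unfolding weak_conv_m_def weak_conv_def by blast
  \<comment> \<open>The limit has positive distribution function at large points. The push-forwards
    inherit this eventually, which excludes the null measure and hence non-measurable
    \<open>X (nk k)\<close>.\<close>
  have meas: "eventually (\<lambda>k. X (nk k) \<in> borel_measurable M) sequentially"
  proof -
    have "eventually (\<lambda>x. 0 < cdf Y x) at_top"
      by (rule order_tendstoD(1)[OF Y.cdf_lim_at_top_prob]) simp
    then obtain a where a: "\<And>x. a \<le> x \<Longrightarrow> 0 < cdf Y x" by (auto simp: eventually_at_top_linorder)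
    obtain x where x: "a < x" "isCont (cdf Y) x" using Y.exists_isCont_cdf_between[of a "a + 1"] by auto
    show ?thesis
      using order_tendstoD(1)[OF lim[OF x(2)] a[of x]] x(1)
      by (auto elim!: eventually_mono intro!: borel_measurable_of_cdf_distr_nonzero[of _ x])
  qed
  have lim': "(\<lambda>k. prob {\<omega> \<in> space M. X (nk k) \<omega> \<le> x}) \<longlonglongrightarrow> cdf Y x" if "isCont (cdf Y) x" for x
  proof (rule Lim_transform_eventually[OF lim[OF that]])
    show "eventually (\<lambda>k. cdf (distr M borel (X (nk k))) x = prob {\<omega> \<in> space M. X (nk k) \<omega> \<le> x}) sequentially"
      using meas
    proof eventually_elim
      case (elim k)
      show ?case
        unfolding cdf_def by (subst measure_distr[OF elim]) (auto intro!: arg_cong[where f = prob])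
    qed
  qed
  have pos: "eventually (\<lambda>k. 1 \<le> nk k) sequentially"
    by (rule eventually_compose_filterlim[OF eventually_ge_at_top sub])
  show "\<exists>K. compact K \<and> measure Y K = 1"
  proof -
    obtain x where x: "18 < x" "isCont (cdf Y) x" using Y.exists_isCont_cdf_between[of 18 19] by auto
    obtain y where y: "y < 0" "isCont (cdf Y) y" using Y.exists_isCont_cdf_between[of "-1" 0] by auto
    have x_ge: "1 - \<epsilon> \<le> cdf Y x" if "0 < \<epsilon>" for \<epsilon>
    proof (rule tendsto_lowerbound[OF lim'[OF x(2)]])
      show "eventually (\<lambda>k. 1 - \<epsilon> \<le> prob {\<omega> \<in> space M. X (nk k) \<omega> \<le> x}) sequentially"
        using meas eventually_compose_filterlim[OF X_le_18[OF that] sub]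
      proof eventually_elim
        case (elim k)
        note [measurable] = elim(1)
        have "1 - prob {\<omega> \<in> space M. X (nk k) \<omega> \<le> x} = prob {\<omega> \<in> space M. \<not> X (nk k) \<omega> \<le> x}"
          by (subst prob_neg) auto
        also have "\<dots> \<le> prob {\<omega> \<in> space M. 18 < \<bar>X (nk k) \<omega>\<bar>}"
          using x by (intro finite_measure_mono) auto
        finally show ?case using elim(2) by linarith
      qed
    qed simp
    have "1 \<le> cdf Y x" by (rule field_le_epsilon) (use x_ge in \<open>simp add: diff_le_eq\<close>)
    then have x1: "cdf Y x = 1" using Y.cdf_bounded_prob[of x] by simp
    have "cdf Y y \<le> 0"
    proof (rule tendsto_upperbound[OF lim'[OF y(2)]])
      show "eventually (\<lambda>k. prob {\<omega> \<in> space M. X (nk k) \<omega> \<le> y} \<le> 0) sequentially"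
        using meas pos
      proof eventually_elim
        case (elim k)
        note [measurable] = elim(1)
        have "prob {\<omega> \<in> space M. X (nk k) \<omega> \<le> y} \<le> prob {\<omega> \<in> space M. X (nk k) \<omega> < 0}"
          using y by (intro finite_measure_mono) auto
        then show ?case using X_negative[OF elim(2)] by simp
      qed
    qed simp
    then have y0: "cdf Y y = 0" using Y.cdf_nonneg[of y] by simp
    have "measure Y {y<..x} = 1" using Y.cdf_diff_eq[of y x] x1 y0 x y by simp
    moreover have "measure Y {y<..x} \<le> measure Y {y..x}" by (intro Y.finite_measure_mono) auto
    ultimately have "measure Y {y..x} = 1" using Y.prob_le_1[of "{y..x}"] by linarith
    then show ?thesis by (intro exI[of _ "{y..x}"]) simp
  qed
  show "\<not> (\<exists>c. measure Y {c} = 1)"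
  proof
    assume "\<exists>c. measure Y {c} = 1"
    then obtain c where c: "measure Y {c} = 1" by blast
    have null: "measure Y A = 0" if "A \<in> sets borel" "c \<notin> A" for A
    proof -
      have "measure Y A + measure Y {c} = measure Y (A \<union> {c})"
        using that by (intro Y.finite_measure_Union[symmetric]) auto
      also have "\<dots> \<le> 1" by (rule Y.prob_le_1)
      finally show ?thesis using c measure_nonneg[of Y A] by linarith
    qed
    have cont: "isCont (cdf Y) x" if "x \<noteq> c" for x using null[of "{x}"] that by (simp add: Y.isCont_cdf)
    show False
    proof (cases "0 < c")
      case True
      \<comment> \<open>A point mass at \<open>c > 0\<close> would give no mass to the half line up
        to \<open>c / 2\<close>, contradicting \<open>X_small_prob\<close>.\<close>
      obtain p where p: "0 < p" "eventually (\<lambda>n. X n \<in> borel_measurable M \<longrightarrow> p \<le> prob {\<omega> \<in> space M. X n \<omega> \<le> c / 2}) sequentially"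
        using X_small_prob[of "c / 2"] True by auto
      have "p \<le> cdf Y (c / 2)"
      proof (rule tendsto_lowerbound[OF lim'[OF cont]])
        show "eventually (\<lambda>k. p \<le> prob {\<omega> \<in> space M. X (nk k) \<omega> \<le> c / 2}) sequentially"
          using eventually_compose_filterlim[OF p(2) sub] meas by eventually_elim simp
      qed (use True in auto)
      moreover have "cdf Y (c / 2) = 0" unfolding cdf_def using True by (intro null) auto
      ultimately show False using p(1) by simp
    next
      case False
      \<comment> \<open>A point mass at \<open>c \<le> 0\<close> would put all mass below
        \<open>\<delta> / 2\<close>, where at most 9/10 is available.\<close>
      have "cdf Y (\<delta> / 2) \<le> 9 / 10"
      proof (rule tendsto_upperbound[OF lim'[OF cont]])
        show "eventually (\<lambda>k. prob {\<omega> \<in> space M. X (nk k) \<omega> \<le> \<delta> / 2} \<le> 9 / 10) sequentially"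
          using eventually_compose_filterlim[OF low(2) sub] meas
        proof eventually_elim
          case (elim k)
          note [measurable] = elim(2)
          have "prob {\<omega> \<in> space M. X (nk k) \<omega> \<le> \<delta> / 2} \<le> prob {\<omega> \<in> space M. X (nk k) \<omega> < \<delta>}"
            using low(1) by (intro finite_measure_mono) auto
          then show ?case using elim(1) by simp
        qed
      qed (use False low(1) in auto)
      moreover have "measure Y {c} \<le> cdf Y (\<delta> / 2)"
        unfolding cdf_def using False low(1) by (intro Y.finite_measure_mono) auto
      ultimately show False using c by simp
    qed
  qed
qed

end

theorem mainTheorem5:
  fixes M :: "'a measure"
    and R :: "nat \<Rightarrow> 'a \<Rightarrow> nat"
    and U :: "nat \<Rightarrow> nat \<Rightarrow> 'a \<Rightarrow> nat"
    and E :: "nat \<Rightarrow> 'a \<Rightarrow> real"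
    and f :: "real \<Rightarrow> real"
  assumes "prob_space M"
    and R_meas: "\<And>k. R k \<in> measurable M (count_space UNIV)"
    and R_pos: "\<And>k \<omega>. \<omega> \<in> space M \<Longrightarrow> 1 \<le> R k \<omega>"
    and R_ident: "\<And>k. distr M (count_space UNIV) (R k) = distr M (count_space UNIV) (R 0)"
    and U_range: "\<And>n k \<omega>. 1 \<le> n \<Longrightarrow> \<omega> \<in> space M \<Longrightarrow> U n k \<omega> < n"
    and U_unif: "\<And>n k j. 1 \<le> n \<Longrightarrow> j < n \<Longrightarrow>
                   measure M {\<omega> \<in> space M. U n k \<omega> = j} = 1 / real n"
    and E_exp: "\<And>k. distributed M lborel (E k) (exponential_density 1)"
    and indep: "\<And>n. 1 \<le> n \<Longrightarrow>
       prob_space.indep_vars M (\<lambda>_. borel)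
         (\<lambda>i \<omega>. case i of Inl k \<Rightarrow> real (R k \<omega>)
                         | Inr (Inl k) \<Rightarrow> real (U n k \<omega>)
                         | Inr (Inr k) \<Rightarrow> E k \<omega>) UNIV"
    and f_def: "\<And>r. f r = measure M {\<omega> \<in> space M. r \<le> real (R 0 \<omega>)}"
    and f_RV: "regvar (-1) f"
    and cond_b: "\<And>\<beta>. 0 < \<beta> \<Longrightarrow> \<beta> < 1 \<Longrightarrow>
       limsup (\<lambda>n::nat. SUP x \<in> {real n powr \<beta> .. real n}.
                  ereal (x * f x / (real n * f (real n)))) < \<infinity>"
    and cond_d: "\<And>\<beta>. 0 < \<beta> \<Longrightarrow> \<beta> < 1 \<Longrightarrow>
       limsup (\<lambda>n::nat. ereal ((\<Sum>i = 1..nat \<lfloor>real n powr \<beta>\<rfloor>. f (real i))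
                  / (f (real n) * real n * ln (real n)))) < \<infinity>"
  shows "(\<forall>\<epsilon>>0. \<exists>K. \<forall>n\<ge>1.
            measure M {\<omega> \<in> space M.
              \<bar>f (real n) * cover_time n (\<lambda>k. U n k \<omega>) (\<lambda>k. R k \<omega>) (\<lambda>k. E k \<omega>)\<bar> > K} < \<epsilon>)
       \<and> (\<forall>nk Y. strict_mono nk \<and> real_distribution Y \<and>
            weak_conv_m (\<lambda>k. distr M borel (\<lambda>\<omega>. f (real (nk k)) *
                 cover_time (nk k) (\<lambda>j. U (nk k) j \<omega>) (\<lambda>j. R j \<omega>) (\<lambda>j. E j \<omega>))) Y
          \<longrightarrow> (\<not> (\<exists>c. measure Y {c} = 1)) \<and> (\<exists>K. compact K \<and> measure Y K = 1))"
proof -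
  interpret prob_space M by fact
  interpret covering_family M R U E f
  proof (intro covering_family.intro covering_family_axioms.intro)
    fix n :: nat assume "1 \<le> n"
    then show "circle_covering M R (U n) E f n"
      using R_meas R_ident U_range U_unif E_exp indep f_def
      by (intro circle_covering.intro circle_covering_axioms.intro prob_space_axioms)
  qed (rule prob_space_axioms f_RV)+
  have X: "X n = (\<lambda>\<omega>. f (real n) * cover_time n (\<lambda>k. U n k \<omega>) (\<lambda>k. R k \<omega>) (\<lambda>k. E k \<omega>))" for n
    by (rule ext) (rule X_def)
  obtain \<delta> where "0 < \<delta>" "eventually (\<lambda>n. prob {\<omega> \<in> space M. X n \<omega> < \<delta>} \<le> 9 / 10) sequentially"
    using X_bounded_away_from_0 cond_b[of "1/2"] cond_d[of "1/2"] by auto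
  from weak_limit[OF _ _ _ this] tight show ?thesis
    unfolding X by blast
qed

end
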